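(* Let $d_n=n+1$ for all $n\ge 1$, let $(k_n)_{n\geq 1}$ be a strictly increasing sequence of positive integers with $k_n\ge 2d_n$ for all $n$, and let $G=\langle s,t\rangle$ be the associated group defined in the context. Then $G$ is a finitely generated torsion-free solvable group of infinite rank such that every finitely generated metabelian subgroup of $G$ is virtually abelian.
   Context: A solvable group has finite rank if there is $k\ge1$ such that all of its finitely generated subgroups are generated by at most $k$ elements; otherwise it has infinite rank. A group is metabelian if its derived subgroup is abelian. Construction of $G$. Let $C_k=\mathbb{Z}/k\mathbb{Z}$ and let $D=\langle a,b\mid a^2=b^2=1\rangle$ be the infinite dihedral group. Let $(d_n)_{n\ge1}$ and $(k_n)_{n\ge 1}$ be strictly increasing sequences of positive integers with $d_1>1$ and $k_n\ge 2d_n$ for all $n$. For $n\ge1$ let $H_n=D^{k_n}\rtimes C_{k_n}$, where $C_{k_n}$ acts on $D^{k_n}$ by cyclic permutation of the factors; the coordinates of $D^{k_n}$ are indexed by $\{1,\dots,k_n\}$, taken modulo $k_n$, and the generator $1\in C_{k_n}$ acts by $f\mapsto (j\mapsto f(j-1))$. Let $\Delta=\mathbb{Z}\times\prod_{n\ge1}H_n$, with projections $\pi_0:\Delta\to\mathbb{Z}$ and $\pi_n:\Delta\to H_n$ for $n\ge1$. Let $\sigma_0$ be a generator of the factor $\mathbb{Z}$, and for $n\geq 1$ let $\sigma_n\in D^{k_n}\le H_n$ be defined by $\sigma_n(1)=a$, $\sigma_n(d_n)=b$, and $\sigma_n(j)=\mathrm{id}$ for $j\ne 1,d_n$. Let $s\in\Delta$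 be the element with $\pi_0(s)=\sigma_0$ and $\pi_n(s)=\sigma_n$ for all $n\ge1$. Let $t\in\Delta$ be the element with $\pi_0(t)=0$ and $\pi_n(t)$ equal to the generator $1$ of $C_{k_n}$ for all $n\ge1$. Then $G$ is the subgroup of $\Delta$ generated by $s$ and $t$. *)

theory Defs
  imports "HOL-Algebra.Algebra"
begin

section \<open>Group-theoretic notions\<close>

definition generated_by_at_most :: "nat \<Rightarrow> ('a, 'b) monoid_scheme \<Rightarrow> bool" where
  "generated_by_at_most r G \<longleftrightarrow>
     (\<exists>S \<subseteq> carrier G. finite S \<and> card S \<le> r \<and> generate G S = carrier G)"

definition finitely_generated :: "('a, 'b) monoid_scheme \<Rightarrow> bool" where
  "finitely_generated G \<longleftrightarrow> (\<exists>S \<subseteq> carrier G. finite S \<and> generate G S = carrier G)"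

definition finite_rank :: "('a, 'b) monoid_scheme \<Rightarrow> bool" where
  "finite_rank G \<longleftrightarrow>
     (\<exists>r \<ge> 1. \<forall>H. subgroup H G \<longrightarrow> finitely_generated (G\<lparr>carrier := H\<rparr>)
                 \<longrightarrow> generated_by_at_most r (G\<lparr>carrier := H\<rparr>))"

definition torsion_free :: "('a, 'b) monoid_scheme \<Rightarrow> bool" where
  "torsion_free G \<longleftrightarrow>
     (\<forall>x \<in> carrier G. \<forall>n::nat. 0 < n \<longrightarrow> x [^]\<^bsub>G\<^esub> n = \<one>\<^bsub>G\<^esub> \<longrightarrow> x = \<one>\<^bsub>G\<^esub>)"

definition metabelian :: "('a, 'b) monoid_scheme \<Rightarrow> bool" where
  "metabelian G \<longleftrightarrow> comm_group (G\<lparr>carrier := derived G (carrier G)\<rparr>)"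

definition virtually_abelian :: "('a, 'b) monoid_scheme \<Rightarrow> bool" where
  "virtually_abelian G \<longleftrightarrow>
     (\<exists>A. subgroup A G \<and> comm_group (G\<lparr>carrier := A\<rparr>) \<and> finite (rcosets\<^bsub>G\<^esub> A))"


section \<open>Groups given by generators and relators\<close>

text \<open>A letter \<open>(x, True)\<close> stands for the generator \<open>x\<close> and \<open>(x, False)\<close> for its formal
  inverse. The relation below is the least congruence on words that contains free cancellation
  and identifies every relator with the empty word, so that its classes are the elements of
  the free group modulo the normal closure of the relators.\<close>

type_synonym 'g word = "('g \<times> bool) list"

inductive pres_eq :: "'g word set \<Rightarrow> 'g word \<Rightarrow> 'g word \<Rightarrow> bool" for R where
  refl: "pres_eq R u u"
| sym: "pres_eq R u v \<Longrightarrow> pres_eq R v u"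
| trans: "pres_eq R u v \<Longrightarrow> pres_eq R v w \<Longrightarrow> pres_eq R u w"
| append: "pres_eq R u u' \<Longrightarrow> pres_eq R v v' \<Longrightarrow> pres_eq R (u @ v) (u' @ v')"
| cancel: "pres_eq R [(x, e), (x, \<not> e)] []"
| relator: "r \<in> R \<Longrightarrow> pres_eq R r []"

definition pres_class :: "'g word set \<Rightarrow> 'g word \<Rightarrow> 'g word set" where
  "pres_class R w = {v. pres_eq R w v}"

definition presented_group :: "'g word set \<Rightarrow> 'g word set monoid" where
  "presented_group R =
     \<lparr>carrier = range (pres_class R),
      monoid.mult = (\<lambda>U V. {w. \<exists>u \<in> U. \<exists>v \<in> V. pres_eq R (u @ v) w}),
      one = pres_class R []\<rparr>"

datatype dih_gen = Gen_a | Gen_b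

definition dih_relators :: "dih_gen word set" where
  "dih_relators = {[(Gen_a, True), (Gen_a, True)], [(Gen_b, True), (Gen_b, True)]}"

definition D_inf :: "dih_gen word set monoid" where
  "D_inf = presented_group dih_relators"

definition dih_a :: "dih_gen word set" where
  "dih_a = pres_class dih_relators [(Gen_a, True)]"

definition dih_b :: "dih_gen word set" where
  "dih_b = pres_class dih_relators [(Gen_b, True)]"


section \<open>The construction\<close>

definition semidirect ::
    "('a, 'c) monoid_scheme \<Rightarrow> ('b, 'd) monoid_scheme \<Rightarrow> ('b \<Rightarrow> 'a \<Rightarrow> 'a) \<Rightarrow> ('a \<times> 'b) monoid" where
  "semidirect N Q \<phi> =
     \<lparr>carrier = carrier N \<times> carrier Q,
      monoid.mult = (\<lambda>(x, p) (y, q). (x \<otimes>\<^bsub>N\<^esub> \<phi> p y, p \<otimes>\<^bsub>Q\<^esub> q)),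
      one = (\<one>\<^bsub>N\<^esub>, \<one>\<^bsub>Q\<^esub>)\<rparr>"

definition dih_power :: "nat \<Rightarrow> (int \<Rightarrow> dih_gen word set) monoid" where
  "dih_power m = product_group {1..int m} (\<lambda>_. D_inf)"

text \<open>The element \<open>c\<close> of \<open>C_m\<close> sends \<open>f\<close> to \<open>j \<mapsto> f (j - c)\<close>; the argument \<open>j - c\<close> is reduced
  modulo \<open>m\<close> to its representative in \<open>{1..m}\<close>.\<close>

definition cyc_shift :: "nat \<Rightarrow> int \<Rightarrow> (int \<Rightarrow> 'a) \<Rightarrow> (int \<Rightarrow> 'a)" where
  "cyc_shift m c f = (\<lambda>j \<in> {1..int m}. f ((j - c - 1) mod int m + 1))"

type_synonym H_elem = "(int \<Rightarrow> dih_gen word set) \<times> int"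

definition H_group :: "nat \<Rightarrow> H_elem monoid" where
  "H_group m = semidirect (dih_power m) (integer_mod_group m) (cyc_shift m)"

definition Delta :: "(nat \<Rightarrow> nat) \<Rightarrow> (int \<times> (nat \<Rightarrow> H_elem)) monoid" where
  "Delta k = integer_group \<times>\<times> product_group {1..} (\<lambda>n. H_group (k n))"

definition sigma :: "nat \<Rightarrow> nat \<Rightarrow> int \<Rightarrow> dih_gen word set" where
  "sigma m e =
     (\<lambda>j \<in> {1..int m}. if j = 1 then dih_a else if j = int e then dih_b else \<one>\<^bsub>D_inf\<^esub>)"

definition elem_s ::
    "int \<Rightarrow> (nat \<Rightarrow> nat) \<Rightarrow> (nat \<Rightarrow> nat) \<Rightarrow> int \<times> (nat \<Rightarrow> H_elem)" where
  "elem_s \<sigma>\<^sub>0 d k = (\<sigma>\<^sub>0, \<lambda>n \<in> {1..}. (sigma (k n) (d n), 0))"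

definition elem_t :: "(nat \<Rightarrow> nat) \<Rightarrow> int \<times> (nat \<Rightarrow> H_elem)" where
  "elem_t k = (0, \<lambda>n \<in> {1..}. (\<one>\<^bsub>dih_power (k n)\<^esub>, 1))"

definition G_group ::
    "int \<Rightarrow> (nat \<Rightarrow> nat) \<Rightarrow> (nat \<Rightarrow> nat) \<Rightarrow> (int \<times> (nat \<Rightarrow> H_elem)) monoid" where
  "G_group \<sigma>\<^sub>0 d k = (Delta k)\<lparr>carrier := generate (Delta k) {elem_s \<sigma>\<^sub>0 d k, elem_t k}\<rparr>"

end

theory Submission
  imports Defs
begin

text \<open>
  Let \<open>D\<close> act on the integers by \<open>a: v \<mapsto> - v\<close> and \<open>b: v \<mapsto> 1 - v\<close>. This action is faithful, so an
  element of \<open>G\<close> is known once the following numbers are: its exponent sum in \<open>t\<close> (the shift), its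
  component in \<open>\<int>\<close> (the height), and for each level \<open>n\<close> and each position \<open>j\<close> modulo \<open>k n\<close> the sign
  and the displacement of an isometry \<open>v \<mapsto> disp + orient * v\<close>. The shift is well defined because
  the \<open>k n\<close> are unbounded. The whole argument runs on the multiplication law of these coordinates,
  which is the content of the locale \<open>dihedral_coordinates\<close>.

  Write \<open>s\<^sub>i\<close> for the conjugate of \<open>s\<close> by \<open>t^i\<close>. In level \<open>n\<close> it has \<open>a\<close> at the position \<open>i + 1\<close>, \<open>b\<close> at
  the position \<open>i + n + 1\<close>, both modulo \<open>k n\<close>, and nothing else. An element of \<open>G\<close> is a word in the
  \<open>s\<^sub>i\<close> times a power of \<open>t\<close>. Two finite sets of integers retain what is needed of the word: its
  parity trace, the set of those \<open>i\<close> for which \<open>s\<^sub>i\<close> has odd exponent sum, and a support,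
  containing all \<open>i\<close> for which \<open>s\<^sub>i\<close> occurs. The parity trace \<open>E\<close> determines every coordinate modulo
  the commutator subgroup of \<open>D\<close>. The support controls large levels: as \<open>n\<close> and \<open>k n - n\<close> both exceed the
  diameter of the support, no position can receive both an \<open>a\<close> and a \<open>b\<close>, and each coordinate lies in
  one of the subgroups of order two generated by \<open>a\<close> and by \<open>b\<close>.

  Solvability. Commutators have shift and height zero; commutators of those are translations
  in every coordinate; and translations commute.

  Torsion. An element \<open>x\<close> of finite order has shift and height zero, so its parity trace \<open>E\<close> has even
  size. If \<open>E\<close> is nonempty, then its maximum \<open>p\<close> and minimum \<open>q\<close> differ, and in the level \<open>n = p - q\<close> the
  coordinate at \<open>p + 1\<close> receives \<open>a\<close> from \<open>p\<close> and \<open>b\<close> from \<open>q\<close>, each an odd number of times: it is a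
  translation by an odd number and has infinite order. Every level \<open>n \<ge> 1\<close> is available since
  \<open>d n = n + 1\<close>. If \<open>E\<close> is empty, then all coordinates are translations and \<open>x\<close> is trivial.

  Rank. In a high level the parities separate \<open>s\<^sub>0, \<dots>, s\<^sub>r\<close>, so these generate a group that maps onto
  an elementary abelian group of order \<open>2^(r + 1)\<close> and needs \<open>r + 1\<close> generators.

  Metabelian subgroups. If finitely many generators commute pairwise in all levels \<open>n \<ge> n\<^sub>0\<close>, then
  requiring translations in the levels below \<open>n\<^sub>0\<close> and a shift divisible by the lengths of these
  levels cuts out an abelian subgroup of finite index (lemma \<open>virtually_abelianI\<close>). Generators of
  shift zero commute in large levels because of their supports. Otherwise let \<open>g\<close> have the least
  positive shift. If every element of shift zero has empty parity trace, then it is trivial in large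
  levels, so there each generator agrees with a power of \<open>g\<close>. If some \<open>x\<close> of shift zero has nonempty
  parity trace, then so does \<open>w = [g, x]\<close>, and for a suitable power \<open>h\<close> of \<open>g\<close> and level \<open>n\<close>
  some coordinate of \<open>w\<close> is a conjugate of \<open>a\<close> where that of the conjugate of \<open>w\<close> by \<open>h\<close> is a conjugate of \<open>b\<close>. Two
  such reflections never commute, so the derived subgroup is not abelian
  (lemma \<open>not_metabelian_if_trace\<close>).
\<close>

section \<open>Auxiliary facts on integers, finite sets and groups\<close>

lemma odd_card_sym_diff:
  assumes "finite A" "finite B"
  shows "odd (card (sym_diff A B)) \<longleftrightarrow> odd (card A) \<noteq> odd (card B)"
proof -
  have "card (sym_diff A B) = card (A - B) + card (B - A)"
    using assms by (intro card_Un_disjoint) auto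
  moreover have "card A = card (A - B) + card (A \<inter> B)"
    using assms by (metis card_Diff_subset_Int card_mono finite_Int inf_le1 le_add_diff_inverse2)
  moreover have "card B = card (B - A) + card (A \<inter> B)"
    using assms
    by (metis card_Diff_subset_Int card_mono finite_Int inf_commute inf_le1 le_add_diff_inverse2)
  ultimately show ?thesis by presburger
qed

lemma int_mod_eq_iff_close:
  fixes i j :: int
  assumes "\<bar>i - j\<bar> < int q"
  shows "i mod int q = j mod int q \<longleftrightarrow> i = j"
proof
  assume "i mod int q = j mod int q"
  then have "int q dvd i - j" by (simp add: mod_eq_dvd_iff)
  then show "i = j"
    using assms dvd_imp_le_int[of "i - j" "int q"] by (cases "i = j") auto
qed simp

lemma finite_int_set_bounded:
  fixes F :: "int set"
  assumes "finite F"
  obtains N :: nat where "\<And>i. i \<in> F \<Longrightarrow> \<bar>i\<bar> \<le> int N"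
proof -
  have "finite ((\<lambda>i. nat \<bar>i\<bar>) ` F)" using assms by simp
  then obtain N where N: "\<forall>m\<in>(\<lambda>i. nat \<bar>i\<bar>) ` F. m \<le> N"
    unfolding finite_nat_set_iff_bounded_le ..
  have "\<bar>i\<bar> \<le> int N" if "i \<in> F" for i
    using bspec[OF N imageI[OF that]] by simp
  then show ?thesis by (rule that)
qed

text \<open>The map \<open>\<phi>\<close> is a finite record of an element, such as some of its coordinates, that determines
  its coset.\<close>

lemma (in group) finite_rcosetsI:
  assumes "subgroup A G" "finite (\<phi> ` carrier G)"
    and "\<And>x y. \<lbrakk>x \<in> carrier G; y \<in> carrier G; \<phi> x = \<phi> y\<rbrakk> \<Longrightarrow> x \<otimes> inv y \<in> A"
  shows "finite (rcosets A)"
proof -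
  have same_coset: "A #> x = A #> y" if "x \<in> carrier G" "y \<in> carrier G" "\<phi> x = \<phi> y" for x y
  proof -
    have "x = (x \<otimes> inv y) \<otimes> y" using that by (simp add: m_assoc)
    then have "x \<in> A #> y" using assms(3)[OF that] by (auto simp: r_coset_def)
    then show ?thesis using repr_independence[of x A y] that(2) assms(1) by simp
  qed
  define rep where "rep c = (SOME x. x \<in> carrier G \<and> \<phi> x = c)" for c
  have rep: "rep (\<phi> x) \<in> carrier G \<and> \<phi> (rep (\<phi> x)) = \<phi> x" if "x \<in> carrier G" for x
    unfolding rep_def by (rule someI[of _ x]) (simp add: that)
  have "rcosets A \<subseteq> (\<lambda>c. A #> rep c) ` (\<phi> ` carrier G)"
  proof
    fix C assume "C \<in> rcosets A"
    then obtain x where "x \<in> carrier G" "C = A #> x" by (auto simp: RCOSETS_def)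
    moreover have "A #> x = A #> rep (\<phi> x)"
      using rep[OF \<open>x \<in> carrier G\<close>] \<open>x \<in> carrier G\<close> by (intro same_coset) auto
    ultimately show "C \<in> (\<lambda>c. A #> rep c) ` (\<phi> ` carrier G)" by blast
  qed
  then show ?thesis using assms(2) finite_surj by blast
qed

text \<open>The map \<open>h\<close> is a homomorphism to a vector space over the field with two elements, given as sets
  under symmetric difference. The image of a group with generating set \<open>S\<close> is spanned by \<open>h ` S\<close>, so each
  of its elements is the sum over a subset of \<open>S\<close>.\<close>

lemma (in group) card_sym_diff_image_generate:
  assumes S: "finite S" "S \<subseteq> carrier G"
    and h: "\<And>x y. \<lbrakk>x \<in> generate G S; y \<in> generate G S\<rbrakk> \<Longrightarrow> h (x \<otimes> y) = sym_diff (h x) (h y)"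
  shows "finite (h ` generate G S) \<and> card (h ` generate G S) \<le> 2 ^ card S"
proof -
  \<comment> \<open>The sum of the \<open>h y\<close> over \<open>y \<in> T\<close>.\<close>
  define span where "span T = {p. odd (card {y \<in> T. p \<in> h y})}" for T
  have sub: "subgroup (generate G S) G" by (rule generate_is_subgroup[OF S(2)])
  have h_one: "h \<one> = {}"
    using h[OF generate.one generate.one] by auto
  have h_inv: "h (inv x) = h x" if "x \<in> generate G S" for x
  proof -
    have "x \<in> carrier G" "inv x \<in> generate G S"
      using that sub by (auto intro: subgroup.mem_carrier subgroup.m_inv_closed)
    then have "sym_diff (h x) (h (inv x)) = {}" using h[of x "inv x"] that h_one by simp
    then show ?thesis by auto
  qed
  have span_single: "span {y} = h y" for y
    unfolding span_def
  proof (rule Set.set_eqI)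
    fix p
    have "{z \<in> {y}. p \<in> h z} = (if p \<in> h y then {y} else {})" by auto
    then show "p \<in> {p. odd (card {z \<in> {y}. p \<in> h z})} \<longleftrightarrow> p \<in> h y" by simp
  qed
  have span_sym_diff: "span (sym_diff T U) = sym_diff (span T) (span U)"
    if "finite T" "finite U" for T U
  proof -
    have "{y \<in> sym_diff T U. p \<in> h y} = sym_diff {y \<in> T. p \<in> h y} {y \<in> U. p \<in> h y}" for p
      by auto
    then show ?thesis
      using that by (auto simp: span_def odd_card_sym_diff)
  qed
  have "\<exists>T\<subseteq>S. h x = span T" if "x \<in> generate G S" for x
    using that
  proof (induction x rule: generate.induct)
    case one
    show ?case using h_one by (intro exI[of _ "{}"]) (simp add: span_def)
  next
    case (incl x)
    then show ?case by (intro exI[of _ "{x}"]) (simp add: span_single)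
  next
    case (inv x)
    then show ?case
      by (intro exI[of _ "{x}"]) (simp add: span_single h_inv generate.incl)
  next
    case (eng x y)
    then obtain T U where TU: "T \<subseteq> S" "U \<subseteq> S" "h x = span T" "h y = span U" by blast
    then have "finite T" "finite U" using S(1) by (blast intro: finite_subset)+
    then show ?case
      using TU h[OF eng.hyps] by (intro exI[of _ "sym_diff T U"]) (auto simp: span_sym_diff)
  qed
  then have sub: "h ` generate G S \<subseteq> span ` Pow S" by blast
  have "card (span ` Pow S) \<le> 2 ^ card S"
    using card_image_le[of "Pow S" span] S(1) by (simp add: card_Pow)
  then show ?thesis
    using card_mono[OF _ sub] finite_subset[OF sub] S(1) by auto
qed

section \<open>Groups with dihedral coordinates\<close>

text \<open>The entry of \<open>x\<close> at level \<open>n\<close> and position \<open>j\<close> is the isometry \<open>v \<mapsto> disp x n j + orient x n j * v\<close> of the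
  integers. Positions are integers on which the entries depend modulo \<open>k n\<close>. Only levels \<open>n \<ge> 1\<close> carry
  information.

  The parameters \<open>shift\<close>, \<open>height\<close>, \<open>orient\<close> and \<open>disp\<close> are plain functions on the type, so that the same
  functions are coordinates on every subgroup.\<close>

locale dihedral_coordinates = group G for G (structure) +
  fixes k :: "nat \<Rightarrow> nat"
    and shift height :: "'a \<Rightarrow> int"
    and orient disp :: "'a \<Rightarrow> nat \<Rightarrow> int \<Rightarrow> int"
  assumes long_cycles: "1 \<le> n \<Longrightarrow> 2 * n + 2 \<le> k n"
    and shift_mult: "\<lbrakk>x \<in> carrier G; y \<in> carrier G\<rbrakk> \<Longrightarrow> shift (x \<otimes> y) = shift x + shift y"
    and height_mult: "\<lbrakk>x \<in> carrier G; y \<in> carrier G\<rbrakk> \<Longrightarrow> height (x \<otimes> y) = height x + height y"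
    and orient_mult: "\<lbrakk>x \<in> carrier G; y \<in> carrier G\<rbrakk>
      \<Longrightarrow> orient (x \<otimes> y) n j = orient x n j * orient y n (j - shift x)"
    and disp_mult: "\<lbrakk>x \<in> carrier G; y \<in> carrier G\<rbrakk>
      \<Longrightarrow> disp (x \<otimes> y) n j = disp x n j + orient x n j * disp y n (j - shift x)"
    and orient_cases: "x \<in> carrier G \<Longrightarrow> orient x n j = 1 \<or> orient x n j = - 1"
    and orient_periodic: "j mod int (k n) = j' mod int (k n) \<Longrightarrow> orient x n j = orient x n j'"
    and disp_periodic: "j mod int (k n) = j' mod int (k n) \<Longrightarrow> disp x n j = disp x n j'"
    and coordinates_eqI: "\<lbrakk>x \<in> carrier G; y \<in> carrier G; shift x = shift y; height x = height y;
      \<And>n j. 1 \<le> n \<Longrightarrow> orient x n j = orient y n j;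
      \<And>n j. 1 \<le> n \<Longrightarrow> disp x n j = disp y n j\<rbrakk> \<Longrightarrow> x = y"
begin

lemma shift_one [simp]: "shift \<one> = 0"
  using shift_mult[of \<one> \<one>] by simp

lemma height_one [simp]: "height \<one> = 0"
  using height_mult[of \<one> \<one>] by simp

lemma orient_one [simp]: "orient \<one> n j = 1"
  using orient_mult[of \<one> \<one> n j] orient_cases[of \<one> n j] by auto

lemma disp_one [simp]: "disp \<one> n j = 0"
  using disp_mult[of \<one> \<one> n j] by simp

lemma shift_inv [simp]: "x \<in> carrier G \<Longrightarrow> shift (inv x) = - shift x"
  using shift_mult[of x "inv x"] by simp

lemma height_inv [simp]: "x \<in> carrier G \<Longrightarrow> height (inv x) = - height x"
  using height_mult[of x "inv x"] by simp

lemma orient_square: "x \<in> carrier G \<Longrightarrow> orient x n j * orient x n j = 1"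
  using orient_cases[of x n j] by auto

lemma orient_inv: "x \<in> carrier G \<Longrightarrow> orient (inv x) n j = orient x n (j + shift x)"
  using orient_mult[of x "inv x" n "j + shift x"] orient_cases[of x n "j + shift x"]
    orient_cases[of "inv x" n j] by auto

lemma disp_inv:
  "x \<in> carrier G \<Longrightarrow> disp (inv x) n j = - orient x n (j + shift x) * disp x n (j + shift x)"
  using disp_mult[of x "inv x" n "j + shift x"] orient_cases[of x n "j + shift x"] by auto

lemma odd_disp_mult:
  assumes "x \<in> carrier G" "y \<in> carrier G"
  shows "odd (disp (x \<otimes> y) n j) \<longleftrightarrow> odd (disp x n j) \<noteq> odd (disp y n (j - shift x))"
  using disp_mult[OF assms, of n j] orient_cases[OF assms(1), of n j] by auto

lemma orient_mult_eq_minus1: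
  assumes "x \<in> carrier G" "y \<in> carrier G"
  shows "orient (x \<otimes> y) n j = - 1 \<longleftrightarrow> (orient x n j = - 1) \<noteq> (orient y n (j - shift x) = - 1)"
  using orient_mult[OF assms, of n j] orient_cases[OF assms(1), of n j]
    orient_cases[OF assms(2), of n "j - shift x"] by auto

lemma shift_nat_pow: "x \<in> carrier G \<Longrightarrow> shift (x [^] (q::nat)) = int q * shift x"
  by (induction q) (auto simp: shift_mult algebra_simps)

lemma shift_int_pow: "x \<in> carrier G \<Longrightarrow> shift (x [^] (q::int)) = q * shift x"
  using shift_nat_pow[of x "nat q"] shift_nat_pow[of x "nat (- q)"]
  by (cases "q < 0") (simp_all add: int_pow_def2 del: pow_nat)

lemma height_nat_pow: "x \<in> carrier G \<Longrightarrow> height (x [^] (q::nat)) = int q * height x"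
  by (induction q) (auto simp: height_mult algebra_simps)

lemma translation_nat_pow:
  assumes "x \<in> carrier G" "shift x = 0" "orient x n j = 1"
  shows "orient (x [^] (q::nat)) n j = 1 \<and> disp (x [^] q) n j = int q * disp x n j"
  using assms by (induction q) (auto simp: orient_mult disp_mult shift_nat_pow algebra_simps)

subsection \<open>Solvability\<close>

text \<open>Upper bounds for derived subgroups reduce to a computation with single commutators.\<close>

lemma derived_subset:
  assumes "H \<subseteq> carrier G" "subgroup N G"
    and "\<And>x y. x \<in> H \<Longrightarrow> y \<in> H \<Longrightarrow> x \<otimes> y \<otimes> inv x \<otimes> inv y \<in> N"
  shows "derived G H \<subseteq> N"
  unfolding derived_def using assms(3) by (intro generate_subgroup_incl assms(2)) auto

lemma shift_height_commutator:
  assumes "x \<in> carrier G" "y \<in> carrier G"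
  shows "shift (x \<otimes> y \<otimes> inv x \<otimes> inv y) = 0" "height (x \<otimes> y \<otimes> inv x \<otimes> inv y) = 0"
  using assms by (simp_all add: shift_mult height_mult)

text \<open>The chain consists of the elements with trivial shift and height, and among these the elements
  all of whose entries are translations.\<close>

lemma solvable_coordinates: "solvable G"
proof -
  define N1 where "N1 = {x \<in> carrier G. shift x = 0 \<and> height x = 0}"
  define N2 where "N2 = {x \<in> N1. \<forall>n j. orient x n j = 1}"
  have N1: "subgroup N1 G"
    by (rule subgroup.intro) (auto simp: N1_def shift_mult height_mult)
  have N2: "subgroup N2 G"
    by (rule subgroup.intro) (auto simp: N2_def N1_def shift_mult height_mult orient_mult orient_inv)
  have 1: "derived G (carrier G) \<subseteq> N1"
    using N1 by (rule derived_subset[rotated]) (auto simp: N1_def shift_height_commutator)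
  have 2: "derived G N1 \<subseteq> N2"
  proof (rule derived_subset[OF _ N2])
    fix x y assume xy: "x \<in> N1" "y \<in> N1"
    then have "orient (x \<otimes> y \<otimes> inv x \<otimes> inv y) n j = 1" for n j
      using orient_cases[of x n j] orient_cases[of y n j]
      by (auto simp: N1_def orient_mult orient_inv shift_mult)
    then show "x \<otimes> y \<otimes> inv x \<otimes> inv y \<in> N2"
      using xy by (auto simp: N2_def N1_def shift_height_commutator)
  qed (auto simp: N1_def)
  have 3: "derived G N2 \<subseteq> {\<one>}"
  proof (rule derived_subset[OF _ triv_subgroup])
    fix x y assume xy: "x \<in> N2" "y \<in> N2"
    then have car: "x \<in> carrier G" "y \<in> carrier G" by (auto simp: N2_def N1_def)
    have "x \<otimes> y = y \<otimes> x"
      using xy by (intro coordinates_eqI)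
        (simp_all add: N2_def N1_def shift_mult height_mult orient_mult disp_mult)
    then have "x \<otimes> y \<otimes> inv x \<otimes> inv y = \<one>"
      using car by (simp add: m_assoc flip: inv_mult_group)
    then show "x \<otimes> y \<otimes> inv x \<otimes> inv y \<in> {\<one>}" by simp
  qed (auto simp: N2_def N1_def)
  have "(derived G ^^ 3) (carrier G) \<subseteq> {\<one>}"
    using order.trans[OF mono_derived[OF order.trans[OF mono_derived[OF 1] 2]] 3]
    by (simp add: numeral_3_eq_3)
  moreover have "\<one> \<in> (derived G ^^ 3) (carrier G)"
    using exp_of_derived_is_subgroup[OF subgroup_self, of 3] by (rule subgroup.one_closed)
  ultimately show ?thesis
    unfolding solvable_iff_trivial_derived_seq by blast
qed

subsection \<open>Parity traces and supports\<close>

text \<open>The conjugate \<open>s\<^sub>i\<close> puts the letter \<open>a\<close> at position \<open>j\<close> of level \<open>n\<close> iff \<open>i\<close> is congruent to \<open>j - 1\<close>, and the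
  letter \<open>b\<close> iff \<open>i\<close> is congruent to \<open>j - 1 - n\<close>. So the indices in \<open>E\<close> that contribute \<open>a\<close> to the entry
  are \<open>hits E n j\<close>, and those that contribute \<open>b\<close> are \<open>hits E n (j - n)\<close>.\<close>

definition hits :: "int set \<Rightarrow> nat \<Rightarrow> int \<Rightarrow> int set" where
  "hits E n j = {i \<in> E. i mod int (k n) = (j - 1) mod int (k n)}"

text \<open>The abelianization of the dihedral group is elementary abelian of order four. A product of
  \<open>a\<close>s and \<open>b\<close>s reverses orientation iff their total number is odd, and has odd displacement
  iff the number of \<open>b\<close>s is odd. Thus \<open>parity_trace x E\<close> says that \<open>x\<close> has, in every entry, the same
  image in the abelianization as the product of the \<open>s\<^sub>i\<close> with \<open>i \<in> E\<close>, and a height of the same parity.\<close>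

definition parity_trace :: "'a \<Rightarrow> int set \<Rightarrow> bool" where
  "parity_trace x E \<longleftrightarrow> finite E \<and> (odd (height x) \<longleftrightarrow> odd (card E))
     \<and> (\<forall>n\<ge>1. \<forall>j.
          (orient x n j = - 1 \<longleftrightarrow> odd (card (hits E n j) + card (hits E n (j - int n))))
        \<and> (odd (disp x n j) \<longleftrightarrow> odd (card (hits E n (j - int n)))))"

text \<open>An entry that receives no \<open>b\<close> lies in the subgroup generated by \<open>a\<close>, the stabilizer of the point \<open>0\<close>;
  one that receives no \<open>a\<close> lies in the subgroup generated by \<open>b\<close>, the stabilizer of \<open>1/2\<close>. The two
  equations say that these points are fixed.\<close>

definition supported :: "'a \<Rightarrow> int set \<Rightarrow> bool" where
  "supported x F \<longleftrightarrow> finite F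
     \<and> (\<forall>n\<ge>1. \<forall>j. (hits F n (j - int n) = {} \<longrightarrow> disp x n j = 0)
                 \<and> (hits F n j = {} \<longrightarrow> 2 * disp x n j = 1 - orient x n j))"

lemma parity_traceD:
  assumes "parity_trace x E"
  shows "finite E" "odd (height x) \<longleftrightarrow> odd (card E)"
    "1 \<le> n \<Longrightarrow> orient x n j = - 1 \<longleftrightarrow> odd (card (hits E n j) + card (hits E n (j - int n)))"
    "1 \<le> n \<Longrightarrow> odd (disp x n j) \<longleftrightarrow> odd (card (hits E n (j - int n)))"
  using assms unfolding parity_trace_def by blast+

lemma hits_translate: "hits ((+) m ` E) n j = (+) m ` hits E n (j - m)"
proof -
  have "(m + i) mod int (k n) = (j - 1) mod int (k n) \<longleftrightarrow>
        i mod int (k n) = (j - m - 1) mod int (k n)" for i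
    by (simp add: mod_eq_dvd_iff algebra_simps)
  then show ?thesis by (auto simp: hits_def)
qed

lemma card_hits_translate: "card (hits ((+) m ` E) n j) = card (hits E n (j - m))"
  by (simp add: hits_translate card_image)

lemma hits_translate_empty: "hits ((+) m ` E) n j = {} \<longleftrightarrow> hits E n (j - m) = {}"
  by (simp add: hits_translate)

lemma finite_hits [simp]: "finite E \<Longrightarrow> finite (hits E n j)"
  by (simp add: hits_def)

lemma hits_sym_diff: "hits (sym_diff A B) n j = sym_diff (hits A n j) (hits B n j)"
  by (auto simp: hits_def)

lemma odd_card_hits_sym_diff:
  "\<lbrakk>finite A; finite B\<rbrakk> \<Longrightarrow>
    odd (card (hits (sym_diff A B) n j)) \<longleftrightarrow> odd (card (hits A n j)) \<noteq> odd (card (hits B n j))"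
  unfolding hits_sym_diff by (rule odd_card_sym_diff) simp_all

lemma parity_trace_one: "parity_trace \<one> {}"
  by (simp add: parity_trace_def hits_def)

text \<open>Exponent parities add up, after the indices of the second factor have been moved past the power
  of \<open>t\<close> in the first.\<close>

lemma parity_trace_mult:
  assumes "x \<in> carrier G" "y \<in> carrier G" "parity_trace x E" "parity_trace y E'"
  shows "parity_trace (x \<otimes> y) (sym_diff E ((+) (shift x) ` E'))"
proof -
  note E = parity_traceD[OF assms(3)] and E' = parity_traceD[OF assms(4)]
  have fin: "finite ((+) (shift x) ` E')" using E'(1) by simp
  let ?E = "sym_diff E ((+) (shift x) ` E')"
  have swap: "j - int n - shift x = j - shift x - int n" for j n by simp
  have "odd (height (x \<otimes> y)) \<longleftrightarrow> odd (card ?E)"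
    unfolding odd_card_sym_diff[OF E(1) fin] using assms E(2) E'(2)
    by (simp add: height_mult card_image)
  moreover have "orient (x \<otimes> y) n j = - 1 \<longleftrightarrow>
        odd (card (hits ?E n j) + card (hits ?E n (j - int n)))"
      "odd (disp (x \<otimes> y) n j) \<longleftrightarrow> odd (card (hits ?E n (j - int n)))" if "1 \<le> n" for n j
    unfolding odd_add odd_card_hits_sym_diff[OF E(1) fin] card_hits_translate
      orient_mult_eq_minus1[OF assms(1,2)] odd_disp_mult[OF assms(1,2)]
      E(3)[OF that] E(4)[OF that] E'(3)[OF that] E'(4)[OF that] swap
    by blast+
  ultimately show ?thesis
    unfolding parity_trace_def using E(1) fin by blast
qed

lemma parity_trace_inv:
  assumes "x \<in> carrier G" "parity_trace x E"
  shows "parity_trace (inv x) ((+) (- shift x) ` E)"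
proof -
  note E = parity_traceD[OF assms(2)]
  let ?E = "(+) (- shift x) ` E"
  have swap: "j - int n - - shift x = j + shift x - int n" "j - - shift x = j + shift x"
    "j - int n + shift x = j + shift x - int n" for j n by simp_all
  have "odd (disp (inv x) n j) \<longleftrightarrow> odd (disp x n (j + shift x))" for n j
    using disp_inv[OF assms(1), of n j] orient_cases[OF assms(1), of n "j + shift x"] by auto
  then have "orient (inv x) n j = - 1 \<longleftrightarrow> odd (card (hits ?E n j) + card (hits ?E n (j - int n)))"
      "odd (disp (inv x) n j) \<longleftrightarrow> odd (card (hits ?E n (j - int n)))" if "1 \<le> n" for n j
    unfolding card_hits_translate swap orient_inv[OF assms(1)]
    using E(3)[OF that] E(4)[OF that] by simp_all
  moreover have "odd (height (inv x)) \<longleftrightarrow> odd (card ?E)"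
    using E(2) assms(1) by (simp add: card_image del: uminus_add_conv_diff)
  ultimately show ?thesis
    unfolding parity_trace_def using E(1) by blast
qed

text \<open>In the abelianization of an entry conjugation by \<open>g\<close> only moves positions, so no trace of \<open>g\<close>
  enters.\<close>

lemma parity_trace_conj:
  assumes g: "g \<in> carrier G" and x: "x \<in> carrier G" "shift x = 0" "parity_trace x E"
  shows "parity_trace (g \<otimes> x \<otimes> inv g) ((+) (shift g) ` E)"
proof -
  note E = parity_traceD[OF x(3)]
  let ?c = "g \<otimes> x \<otimes> inv g"
  have c: "?c \<in> carrier G" "shift ?c = 0" "height ?c = height x" "?c \<otimes> g = g \<otimes> x"
    using g x by (simp_all add: shift_mult height_mult m_assoc)
  let ?E = "(+) (shift g) ` E"
  have swap: "j - int n - shift g = j - shift g - int n" for j n by simp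
  have "orient ?c n j = orient x n (j - shift g)" for n j
    using orient_mult[OF c(1) g, of n j] orient_mult[OF g x(1), of n j] c
      orient_cases[OF g, of n j] by auto
  moreover have "odd (disp ?c n j) = odd (disp x n (j - shift g))" for n j
    using odd_disp_mult[OF c(1) g, of n j] odd_disp_mult[OF g x(1), of n j] c by auto
  ultimately have "orient ?c n j = - 1 \<longleftrightarrow> odd (card (hits ?E n j) + card (hits ?E n (j - int n)))"
      "odd (disp ?c n j) \<longleftrightarrow> odd (card (hits ?E n (j - int n)))" if "1 \<le> n" for n j
    unfolding card_hits_translate swap using E(3)[OF that] E(4)[OF that] by simp_all
  moreover have "odd (height ?c) \<longleftrightarrow> odd (card ?E)"
    using E(2) c(3) by (simp add: card_image)
  ultimately show ?thesis
    unfolding parity_trace_def using E(1) by blast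
qed

lemma supportedD:
  assumes "supported x F"
  shows "finite F"
    "\<lbrakk>1 \<le> n; hits F n (j - int n) = {}\<rbrakk> \<Longrightarrow> disp x n j = 0"
    "\<lbrakk>1 \<le> n; hits F n j = {}\<rbrakk> \<Longrightarrow> 2 * disp x n j = 1 - orient x n j"
  using assms by (simp_all add: supported_def)

lemma supportedI:
  assumes "finite F"
    and "\<And>n j. \<lbrakk>1 \<le> n; hits F n (j - int n) = {}\<rbrakk> \<Longrightarrow> disp x n j = 0"
    and "\<And>n j. \<lbrakk>1 \<le> n; hits F n j = {}\<rbrakk> \<Longrightarrow> 2 * disp x n j = 1 - orient x n j"
  shows "supported x F"
  using assms by (simp add: supported_def)

lemma hits_Un_empty: "hits (E \<union> E') n j = {} \<longleftrightarrow> hits E n j = {} \<and> hits E' n j = {}"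
  by (auto simp: hits_def)

lemma supported_mono:
  assumes "supported x F" "F \<subseteq> F'" "finite F'"
  shows "supported x F'"
proof -
  have "hits F n j = {}" if "hits F' n j = {}" for n j
    using that assms(2) by (auto simp: hits_def)
  then show ?thesis
    by (intro supportedI assms(3)) (auto intro: supportedD[OF assms(1)])
qed

lemma supported_one: "supported \<one> {}"
  by (simp add: supported_def)

text \<open>The stabilizers of \<open>0\<close> and \<open>1/2\<close> are subgroups, so an entry of the product stays in one of them
  when both factors do.\<close>

lemma supported_mult:
  assumes x: "x \<in> carrier G" "supported x F" and y: "y \<in> carrier G" "supported y F'"
  shows "supported (x \<otimes> y) (F \<union> (+) (shift x) ` F')"
proof (rule supportedI)
  show "finite (F \<union> (+) (shift x) ` F')"
    using supportedD(1)[OF x(2)] supportedD(1)[OF y(2)] by simp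
next
  fix n :: nat and j
  have swap: "j - int n - shift x = j - shift x - int n" by simp
  assume n: "1 \<le> n" and "hits (F \<union> (+) (shift x) ` F') n (j - int n) = {}"
  then have "hits F n (j - int n) = {}" "hits F' n (j - shift x - int n) = {}"
    unfolding hits_Un_empty hits_translate_empty swap by simp_all
  then have "disp x n j = 0" "disp y n (j - shift x) = 0"
    using n supportedD(2)[OF x(2)] supportedD(2)[OF y(2)] by simp_all
  then show "disp (x \<otimes> y) n j = 0" using x y by (simp add: disp_mult)
next
  fix n :: nat and j
  assume n: "1 \<le> n" and "hits (F \<union> (+) (shift x) ` F') n j = {}"
  then have "hits F n j = {}" "hits F' n (j - shift x) = {}"
    unfolding hits_Un_empty hits_translate_empty by simp_all
  then have "2 * disp x n j = 1 - orient x n j"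
    "2 * disp y n (j - shift x) = 1 - orient y n (j - shift x)"
    using n supportedD(3)[OF x(2)] supportedD(3)[OF y(2)] by simp_all
  then show "2 * disp (x \<otimes> y) n j = 1 - orient (x \<otimes> y) n j"
    using orient_cases[OF x(1), of n j] by (auto simp: disp_mult orient_mult x(1) y(1))
qed

lemma supported_inv:
  assumes x: "x \<in> carrier G" "supported x F"
  shows "supported (inv x) ((+) (- shift x) ` F)"
proof (rule supportedI)
  show "finite ((+) (- shift x) ` F)"
    using supportedD(1)[OF x(2)] by simp
next
  fix n :: nat and j
  have swap: "j - int n - - shift x = j + shift x - int n" by simp
  assume n: "1 \<le> n" and "hits ((+) (- shift x) ` F) n (j - int n) = {}"
  then have "disp x n (j + shift x) = 0"
    unfolding hits_translate_empty swap by (rule supportedD(2)[OF x(2)])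
  then show "disp (inv x) n j = 0" by (simp add: disp_inv[OF x(1)])
next
  fix n :: nat and j
  have swap: "j - - shift x = j + shift x" by simp
  assume n: "1 \<le> n" and "hits ((+) (- shift x) ` F) n j = {}"
  then have "2 * disp x n (j + shift x) = 1 - orient x n (j + shift x)"
    unfolding hits_translate_empty swap by (rule supportedD(3)[OF x(2)])
  then show "2 * disp (inv x) n j = 1 - orient (inv x) n j"
    unfolding disp_inv[OF x(1)] orient_inv[OF x(1)]
    using orient_cases[OF x(1), of n "j + shift x"] by auto
qed

lemma hits_single:
  assumes "p \<in> E" "\<And>i. i \<in> E \<Longrightarrow> \<bar>i - p\<bar> < int (k n)"
  shows "hits E n (p + 1) = {p}"
  using assms int_mod_eq_iff_close by (auto simp: hits_def)

lemma hits_none: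
  assumes "\<And>i. i \<in> E \<Longrightarrow> i \<noteq> p \<and> \<bar>i - p\<bar> < int (k n)"
  shows "hits E n (p + 1) = {}"
  using assms int_mod_eq_iff_close by (force simp: hits_def)

text \<open>An \<open>a\<close> and a \<open>b\<close> at the same position come from indices whose difference is congruent to \<open>n\<close>
  modulo \<open>k n\<close>. Differences of elements of \<open>F\<close> are bounded, whereas \<open>n\<close> and \<open>k n - n\<close> both tend to
  infinity.\<close>

lemma eventually_hits_disjoint:
  assumes "finite F"
  shows "\<forall>\<^sub>F n in sequentially. \<forall>j. hits F n j = {} \<or> hits F n (j - int n) = {}"
proof -
  obtain N where N: "\<And>i. i \<in> F \<Longrightarrow> \<bar>i\<bar> \<le> int N"
    using finite_int_set_bounded[OF assms] by blast
  have "hits F n j = {} \<or> hits F n (j - int n) = {}" if n: "n \<ge> 2 * N + 1" for n j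
  proof (rule ccontr)
    assume "\<not> ?thesis"
    then obtain i i' where i: "i \<in> F" "i' \<in> F"
      "i mod int (k n) = (j - 1) mod int (k n)" "i' mod int (k n) = (j - int n - 1) mod int (k n)"
      by (auto simp: hits_def)
    then have "int (k n) dvd (i - (j - 1)) - (i' - (j - int n - 1))"
      by (simp only: mod_eq_dvd_iff) (rule dvd_diff)
    then have "int (k n) dvd i - i' - int n" by (simp add: algebra_simps)
    moreover have "i - i' - int n \<noteq> 0" "\<bar>i - i' - int n\<bar> < int (k n)"
      using N[OF i(1)] N[OF i(2)] n long_cycles[of n] by auto
    ultimately show False using dvd_imp_le_int[of "i - i' - int n" "int (k n)"] by linarith
  qed
  then show ?thesis unfolding eventually_sequentially by blast
qed

subsection \<open>Agreement in one level\<close>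

text \<open>Equality in the image of \<open>x \<mapsto> (shift x, entries of x in level n)\<close>, which is a homomorphism to the
  semidirect product of the entries of level \<open>n\<close> with the integers.\<close>

definition same_at :: "nat \<Rightarrow> 'a \<Rightarrow> 'a \<Rightarrow> bool" where
  "same_at n x y \<longleftrightarrow>
     shift x = shift y \<and> (\<forall>j. orient x n j = orient y n j \<and> disp x n j = disp y n j)"

lemma same_at_refl: "same_at n x x"
  by (simp add: same_at_def)

lemma same_at_sym: "same_at n x y \<Longrightarrow> same_at n y x"
  by (simp add: same_at_def)

lemma same_at_trans [trans]: "same_at n x y \<Longrightarrow> same_at n y z \<Longrightarrow> same_at n x z"
  by (simp add: same_at_def)

lemma same_at_mult:
  "\<lbrakk>same_at n x x'; same_at n y y'; x \<in> carrier G; x' \<in> carrier G; y \<in> carrier G; y' \<in> carrier G\<rbrakk>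
    \<Longrightarrow> same_at n (x \<otimes> y) (x' \<otimes> y')"
  by (simp add: same_at_def shift_mult orient_mult disp_mult)

text \<open>The elements that commute with \<open>a\<close> in level \<open>n\<close> form a subgroup.\<close>

lemma same_at_commute_generate:
  assumes "a \<in> carrier G" "S \<subseteq> carrier G" "\<And>y. y \<in> S \<Longrightarrow> same_at n (a \<otimes> y) (y \<otimes> a)"
    and "y \<in> generate G S"
  shows "same_at n (a \<otimes> y) (y \<otimes> a)"
  using assms(4)
proof (induction y rule: generate.induct)
  case one
  show ?case using assms(1) by (simp add: same_at_refl)
next
  case (incl y)
  then show ?case by (rule assms(3))
next
  case (inv y)
  then have y: "y \<in> carrier G" using assms(2) by blast
  have "same_at n (inv y \<otimes> (y \<otimes> a) \<otimes> inv y) (inv y \<otimes> (a \<otimes> y) \<otimes> inv y)"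
    using assms(1) y
    by (intro same_at_mult[OF same_at_mult[OF same_at_refl same_at_sym[OF assms(3)[OF inv]]]
          same_at_refl]) auto
  moreover have "inv y \<otimes> (y \<otimes> a) \<otimes> inv y = a \<otimes> inv y"
    using assms(1) y by (metis inv_closed m_assoc l_inv l_one m_closed)
  moreover have "inv y \<otimes> (a \<otimes> y) \<otimes> inv y = inv y \<otimes> a"
    using assms(1) y by (simp add: m_assoc)
  ultimately show ?case by simp
next
  case (eng y z)
  then have yz: "y \<in> carrier G" "z \<in> carrier G"
    using generate_in_carrier[OF assms(2)] by auto
  have "same_at n ((a \<otimes> y) \<otimes> z) ((y \<otimes> a) \<otimes> z)"
    using yz assms(1) by (intro same_at_mult[OF eng.IH(1) same_at_refl]) auto
  also have "(y \<otimes> a) \<otimes> z = y \<otimes> (a \<otimes> z)" using yz assms(1) by (simp add: m_assoc)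
  also have "same_at n (y \<otimes> (a \<otimes> z)) (y \<otimes> (z \<otimes> a))"
    using yz assms(1) by (intro same_at_mult[OF same_at_refl eng.IH(2)]) auto
  finally show ?case using yz assms(1) by (simp add: m_assoc)
qed

text \<open>From some level \<open>n0\<close> on, everything commutes. The finitely many levels below \<open>n0\<close> have finitely many
  positions; requiring that the entries there are translations and that the shift is divisible by
  the product \<open>L\<close> of their lengths, so that it moves no position there, costs only finite index and
  makes these levels commute as well.\<close>

lemma virtually_abelianI:
  assumes "S \<subseteq> carrier G" "generate G S = carrier G"
    and "\<forall>\<^sub>F n in sequentially. \<forall>x\<in>S. \<forall>y\<in>S. same_at n (x \<otimes> y) (y \<otimes> x)"
  shows "virtually_abelian G"
proof -
  from assms(3) obtain n0 where n0: "\<forall>n\<ge>n0. \<forall>x\<in>S. \<forall>y\<in>S. same_at n (x \<otimes> y) (y \<otimes> x)"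
    unfolding eventually_sequentially ..
  have S: "same_at n (x \<otimes> y) (y \<otimes> x)" if "n0 \<le> n" "x \<in> S" "y \<in> S" for n x y
    using n0 that by simp
  have comm: "same_at n (x \<otimes> y) (y \<otimes> x)"
    if n: "n0 \<le> n" and xy: "x \<in> carrier G" "y \<in> carrier G" for n x y
  proof (rule same_at_commute_generate[OF xy(1) assms(1)])
    fix z assume "z \<in> S"
    then have "z \<in> carrier G" using assms(1) by blast
    then have "same_at n (z \<otimes> x) (x \<otimes> z)"
      using xy(1) assms(2)
      by (intro same_at_commute_generate[OF _ assms(1) S[OF n \<open>z \<in> S\<close>]]) simp_all
    then show "same_at n (x \<otimes> z) (z \<otimes> x)" by (rule same_at_sym)
  qed (use xy assms in simp)
  define L where "L = (\<Prod>n\<in>{1..<n0}. int (k n))"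
  have "L > 0"
    unfolding L_def using long_cycles by (intro prod_pos) force
  have k_dvd_L: "int (k n) dvd L" if "n \<in> {1..<n0}" for n
    unfolding L_def using that by (intro dvd_prodI) auto
  have periodic: "orient y n (j - c) = orient y n j" "disp y n (j - c) = disp y n j"
    if "L dvd c" "n \<in> {1..<n0}" for y n j c
  proof -
    have "(j - c) mod int (k n) = j mod int (k n)"
      using dvd_trans[OF k_dvd_L[OF that(2)] that(1)] by (simp add: mod_eq_dvd_iff)
    then show "orient y n (j - c) = orient y n j" "disp y n (j - c) = disp y n j"
      by (blast intro: orient_periodic disp_periodic)+
  qed
  define A where "A = {x \<in> carrier G. L dvd shift x \<and> (\<forall>n\<in>{1..<n0}. \<forall>j. orient x n j = 1)}"
  have A: "subgroup A G"
    by (rule subgroup.intro) (auto simp: A_def shift_mult orient_mult orient_inv)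
  have "x \<otimes> y = y \<otimes> x" if "x \<in> A" "y \<in> A" for x y
  proof (rule coordinates_eqI)
    fix n :: nat and j assume n: "1 \<le> n"
    have "orient (x \<otimes> y) n j = orient (y \<otimes> x) n j \<and> disp (x \<otimes> y) n j = disp (y \<otimes> x) n j"
    proof (cases "n < n0")
      case True
      with n have "n \<in> {1..<n0}" by simp
      then show ?thesis using that
        by (auto simp: A_def orient_mult disp_mult periodic)
    next
      case False
      then show ?thesis using comm[of n x y] that by (auto simp: A_def same_at_def)
    qed
    then show "orient (x \<otimes> y) n j = orient (y \<otimes> x) n j" "disp (x \<otimes> y) n j = disp (y \<otimes> x) n j"
      by blast+
  qed (use that in \<open>auto simp: A_def shift_mult height_mult\<close>)
  then have "comm_group (G\<lparr>carrier := A\<rparr>)"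
    using subgroup.subgroup_is_group[OF A is_group]
    by (intro group.group_comm_groupI) auto
  moreover have "finite (rcosets A)"
  proof (rule finite_rcosetsI[OF A])
    let ?I = "SIGMA n:{1..<n0}. {0..<int (k n)}"
    let ?\<phi> = "\<lambda>x. (shift x mod L, {p \<in> ?I. orient x (fst p) (snd p) = - 1})"
    have "?\<phi> ` carrier G \<subseteq> {0..<L} \<times> Pow ?I"
      using \<open>L > 0\<close> by auto
    then show "finite (?\<phi> ` carrier G)"
      by (rule finite_subset) auto
    fix x y assume xy: "x \<in> carrier G" "y \<in> carrier G" "?\<phi> x = ?\<phi> y"
    then have dvd: "L dvd shift x - shift y" by (simp add: mod_eq_dvd_iff)
    have "orient x n j = orient y n j" if n: "n \<in> {1..<n0}" for n j
    proof -
      let ?j = "j mod int (k n)"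
      have "(n, ?j) \<in> ?I" using n long_cycles[of n] by auto
      then have "orient x n ?j = - 1 \<longleftrightarrow> orient y n ?j = - 1"
        using xy(3) by fastforce
      moreover have "orient z n ?j = orient z n j" for z
        by (rule orient_periodic) simp
      ultimately show ?thesis
        using orient_cases[OF xy(1), of n j] orient_cases[OF xy(2), of n j] by auto
    qed
    moreover have "orient (x \<otimes> inv y) n j = orient x n j * orient y n (j - (shift x - shift y))" for n j
      using xy by (simp add: orient_mult orient_inv algebra_simps)
    ultimately show "x \<otimes> inv y \<in> A"
      using xy dvd by (simp add: A_def shift_mult periodic orient_square)
  qed
  ultimately show ?thesis using A unfolding virtually_abelian_def by blast
qed

subsection \<open>Large levels and derived subgroups\<close>

text \<open>In a large level the two entries at a position lie in the same subgroup of order two.\<close>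

lemma eventually_commute_supported:
  assumes "x \<in> carrier G" "y \<in> carrier G" "shift x = 0" "shift y = 0"
    and "supported x F" "supported y F"
  shows "\<forall>\<^sub>F n in sequentially. same_at n (x \<otimes> y) (y \<otimes> x)"
  using eventually_hits_disjoint[OF supportedD(1)[OF assms(5)]] eventually_ge_at_top[of 1]
proof eventually_elim
  case (elim n)
  have "orient (x \<otimes> y) n j = orient (y \<otimes> x) n j \<and> disp (x \<otimes> y) n j = disp (y \<otimes> x) n j" for j
  proof (cases "hits F n (j - int n) = {}")
    case True
    then show ?thesis
      using supportedD(2)[OF assms(5) elim(2) True] supportedD(2)[OF assms(6) elim(2) True]
      by (simp add: orient_mult disp_mult assms)
  next
    case False
    then have "hits F n j = {}" using elim(1) by blast
    from supportedD(3)[OF assms(5) elim(2) this] supportedD(3)[OF assms(6) elim(2) this]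
    show ?thesis
      using orient_cases[OF assms(1), of n j] orient_cases[OF assms(2), of n j]
      by (auto simp: orient_mult disp_mult assms)
  qed
  then show ?case by (simp add: same_at_def shift_mult assms)
qed

text \<open>In a large level each entry lies in a subgroup of order two that meets the commutator
  subgroup of the dihedral group trivially.\<close>

lemma eventually_trivial_if_no_trace:
  assumes "x \<in> carrier G" "shift x = 0" "parity_trace x {}" "supported x F"
  shows "\<forall>\<^sub>F n in sequentially. same_at n x \<one>"
  using eventually_hits_disjoint[OF supportedD(1)[OF assms(4)]] eventually_ge_at_top[of 1]
proof eventually_elim
  case (elim n)
  have "orient x n j = 1 \<and> disp x n j = 0" for j
  proof -
    have "orient x n j = 1"
      using parity_traceD(3)[OF assms(3) elim(2), of j] orient_cases[OF assms(1), of n j]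
      by (auto simp: hits_def)
    moreover have "disp x n j = 0 \<or> 2 * disp x n j = 1 - orient x n j"
      using elim supportedD(2,3)[OF assms(4) elim(2)] by blast
    ultimately show ?thesis by auto
  qed
  then show ?case by (simp add: same_at_def assms)
qed

text \<open>Two reflections of the line commute only if they have the same center, and the displacement is
  twice the center.\<close>

lemma not_commute_if_parities_differ:
  assumes "x \<in> carrier G" "y \<in> carrier G" "shift x = 0" "shift y = 0"
    and "orient x n j = - 1" "orient y n j = - 1" "odd (disp x n j) \<noteq> odd (disp y n j)"
  shows "x \<otimes> y \<noteq> y \<otimes> x"
proof
  assume "x \<otimes> y = y \<otimes> x"
  then have "disp (x \<otimes> y) n j = disp (y \<otimes> x) n j" by simp
  then have "disp x n j = disp y n j" using assms by (simp add: disp_mult)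
  then show False using assms by simp
qed

text \<open>Let \<open>w = [g, x]\<close>, whose parity trace is the symmetric difference of \<open>E\<close> and a translate of \<open>E\<close> and
  hence nonempty. Conjugation of \<open>w\<close> by the power of \<open>g\<close> of shift \<open>- n\<close> moves the trace by \<open>- n\<close>, so an
  index \<open>p\<close> of the trace that contributes \<open>a\<close> at the position \<open>p + 1\<close> of level \<open>n\<close> contributes \<open>b\<close> there after
  the conjugation. For large \<open>n\<close> no other index interferes, and both elements have a reflection at
  this position, with displacements of different parity.\<close>

lemma not_metabelian_if_trace:
  assumes g: "g \<in> carrier G" "shift g > 0"
    and x: "x \<in> carrier G" "shift x = 0" "parity_trace x E" "E \<noteq> {}"
  shows "\<not> metabelian G"
proof
  assume "metabelian G"
  then have comm: "u \<otimes> v = v \<otimes> u"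
    if "u \<in> derived G (carrier G)" "v \<in> derived G (carrier G)" for u v
    using comm_monoid.m_comm[OF comm_group.axioms(1)] that
    unfolding metabelian_def by fastforce
  define w where "w = g \<otimes> x \<otimes> inv g \<otimes> inv x"
  have w: "w \<in> carrier G" "shift w = 0" "w \<in> derived G (carrier G)"
    using g x unfolding w_def derived_def
    by (auto simp: shift_mult intro!: generate.incl)
  obtain E1 p where trace_w: "parity_trace w E1" and p: "p \<in> E1"
  proof
    \<comment> \<open>The two trivial translations are left over from the rules for inverses and products.\<close>
    let ?E = "sym_diff ((+) (shift g) ` E) ((+) 0 ` ((+) 0 ` E))"
    show "parity_trace w ?E"
      unfolding w_def
      using parity_trace_mult[OF _ _ parity_trace_conj[OF g(1) x(1-3)] parity_trace_inv[OF x(1,3)]] g x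
      by (simp add: shift_mult)
    have "Max E + shift g \<notin> E"
      using parity_traceD(1)[OF x(3)] g(2) Max_ge[of E "Max E + shift g"] by auto
    then show "shift g + Max E \<in> ?E"
      using Max_in[OF parity_traceD(1)[OF x(3)] x(4)] by (auto simp: add.commute)
  qed
  obtain N where N: "\<And>i. i \<in> E1 \<Longrightarrow> \<bar>i\<bar> \<le> int N"
    using finite_int_set_bounded[OF parity_traceD(1)[OF trace_w]] by blast
  \<comment> \<open>A multiple of the shift of \<open>g\<close> that exceeds the diameter of the trace.\<close>
  define n where "n = (2 * N + 1) * nat (shift g)"
  have "(2 * N + 1) * 1 \<le> n" unfolding n_def using g(2) by (intro mult_left_mono) auto
  then have n: "2 * N + 1 \<le> n" "1 \<le> n" by auto
  define h where "h = inv (g [^] (2 * N + 1))"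
  have "shift (g [^] (2 * N + 1)) = int n"
    unfolding shift_nat_pow[OF g(1)] n_def using g(2) by (simp add: algebra_simps)
  then have h: "h \<in> carrier G" "shift h = - int n"
    unfolding h_def using g(1) by (simp_all del: nat_pow_Suc)
  define w' where "w' = h \<otimes> w \<otimes> inv h"
  have w': "w' \<in> carrier G" "shift w' = 0"
    using h w by (auto simp: w'_def shift_mult)
  have "w' \<in> derived G (carrier G)"
    unfolding w'_def by (rule normal.inv_op_closed2[OF derived_self_is_normal h(1) w(3)])
  have trace_w': "parity_trace w' ((+) (- int n) ` E1)"
    using parity_trace_conj[OF h(1) w(1,2) trace_w] h(2) by (simp add: w'_def)
  have close: "\<bar>i - p\<bar> \<le> 2 * int N" if "i \<in> E1" for i
    using N[OF p] N[OF that] by auto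
  have 1: "hits E1 n (p + 1) = {p}"
  proof (rule hits_single[OF p])
    fix i assume "i \<in> E1"
    from close[OF this] show "\<bar>i - p\<bar> < int (k n)" using n(1) long_cycles[OF n(2)] by linarith
  qed
  have 2: "hits E1 n ((p - int n) + 1) = {}" and 3: "hits E1 n ((p + int n) + 1) = {}"
  proof -
    have "i \<noteq> p - int n \<and> \<bar>i - (p - int n)\<bar> < int (k n)"
      "i \<noteq> p + int n \<and> \<bar>i - (p + int n)\<bar> < int (k n)" if "i \<in> E1" for i
      using close[OF that] n(1) long_cycles[OF n(2)] by linarith+
    then show "hits E1 n ((p - int n) + 1) = {}" "hits E1 n ((p + int n) + 1) = {}"
      by (simp_all add: hits_none)
  qed
  have eqs: "p + 1 - int n = (p - int n) + 1" "p + 1 - - int n = (p + int n) + 1"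
    "p - int n + 1 - - int n = p + 1" by simp_all
  have "orient w n (p + 1) = - 1" "even (disp w n (p + 1))"
    using parity_traceD(3,4)[OF trace_w n(2), of "p + 1"] unfolding eqs 1 2 by simp_all
  moreover have "orient w' n (p + 1) = - 1" "odd (disp w' n (p + 1))"
    using parity_traceD(3,4)[OF trace_w' n(2), of "p + 1"]
    unfolding card_hits_translate eqs 1 3 by simp_all
  ultimately have "w \<otimes> w' \<noteq> w' \<otimes> w"
    using not_commute_if_parities_differ[OF w(1) w'(1) w(2) w'(2)] by blast
  then show False using comm w(3) \<open>w' \<in> derived G (carrier G)\<close> by blast
qed

subsection \<open>Infinite rank\<close>

text \<open>The conjugates \<open>c i\<close> of \<open>s\<close> have parity traces \<open>{i}\<close>. In the level \<open>r + 1\<close>, which has more than \<open>2 * r\<close>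
  positions, the parity of the number of \<open>a\<close>s at position \<open>p + 1\<close> detects \<open>c p\<close> among \<open>c 0\<close>, ..., \<open>c r\<close>,
  so the subgroup that they generate has an elementary abelian quotient of order \<open>2 ^ (r + 1)\<close>.\<close>

lemma infinite_rank:
  assumes t: "t \<in> carrier G" "shift t = 1"
    and s: "s \<in> carrier G" "shift s = 0" "parity_trace s {0}"
  shows "\<not> finite_rank G"
proof
  assume "finite_rank G"
  then obtain r where r: "\<And>H. \<lbrakk>subgroup H G; finitely_generated (G\<lparr>carrier := H\<rparr>)\<rbrakk>
      \<Longrightarrow> generated_by_at_most r (G\<lparr>carrier := H\<rparr>)"
    unfolding finite_rank_def by blast
  define c where "c i = t [^] i \<otimes> s \<otimes> inv (t [^] i)" for i :: nat
  have c: "c i \<in> carrier G" "shift (c i) = 0" "parity_trace (c i) {int i}" for i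
    using parity_trace_conj[OF _ s, of "t [^] i"] s t
    by (auto simp: c_def shift_mult shift_nat_pow)
  define S where "S = c ` {0..r}"
  define H where "H = generate G S"
  have S: "S \<subseteq> carrier G" "finite S" by (auto simp: S_def c(1))
  have H: "subgroup H G" unfolding H_def by (rule generate_is_subgroup[OF S(1)])
  have "S \<subseteq> H" unfolding H_def by (auto intro: generate.incl)
  then have "finitely_generated (G\<lparr>carrier := H\<rparr>)"
    unfolding finitely_generated_def using S(2) generate_consistent[OF _ H, of S] H_def by auto
  then obtain T where T: "T \<subseteq> H" "finite T" "card T \<le> r" "generate G T = H"
    using r[OF H] generate_consistent[OF _ H] unfolding generated_by_at_most_def by auto
  have Hc: "x \<in> carrier G" if "x \<in> H" for x
    using that subgroup.mem_carrier[OF H] by blast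
  have shift0: "shift x = 0" if "x \<in> H" for x
    using that unfolding H_def
  proof (induction x rule: generate.induct)
    case (eng x y)
    then show ?case using Hc by (simp add: H_def shift_mult)
  qed (auto simp: S_def c)
  define n where "n = r + 1"
  have n: "1 \<le> n" "r < n" by (simp_all add: n_def)
  \<comment> \<open>Orientation counts all letters and displacement the \<open>b\<close>s, so their discrepancy counts the \<open>a\<close>s.\<close>
  define h where
    "h x = {p \<in> {0..int r}. (orient x n (p + 1) = - 1) \<noteq> odd (disp x n (p + 1))}" for x
  have h_mult: "h (x \<otimes> y) = sym_diff (h x) (h y)" if "x \<in> H" "y \<in> H" for x y
    using Hc[OF that(1)] Hc[OF that(2)] shift0[OF that(1)]
    by (auto simp: h_def orient_mult_eq_minus1 odd_disp_mult)
  have h_c: "h (c i) = {int i}" if "i \<le> r" for i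
  proof -
    have "(orient (c i) n (p + 1) = - 1) \<noteq> odd (disp (c i) n (p + 1)) \<longleftrightarrow> p = int i"
      if p: "p \<in> {0..int r}" for p
    proof -
      have "\<bar>int i - p\<bar> < int (k n)" using p \<open>i \<le> r\<close> n long_cycles[OF n(1)] by auto
      then have "hits {int i} n (p + 1) = (if p = int i then {int i} else {})"
        using int_mod_eq_iff_close by (auto simp: hits_def)
      then show ?thesis
        using parity_traceD(3,4)[OF c(3) n(1), of i "p + 1"] by auto
    qed
    moreover have "int i \<in> {0..int r}" using that by simp
    ultimately have "p \<in> h (c i) \<longleftrightarrow> p = int i" for p
      unfolding h_def mem_Collect_eq by metis
    then show ?thesis by blast
  qed
  have "\<exists>x\<in>H. h x = P" if "P \<subseteq> {0..int r}" for P
    using finite_subset[OF that finite_atLeastAtMost_int] that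
  proof (induction P rule: finite_induct)
    case empty
    have "h \<one> = {}" by (simp add: h_def)
    then show ?case using subgroup.one_closed[OF H] by blast
  next
    case (insert p P)
    then obtain x where x: "x \<in> H" "h x = P" by auto
    have "c (nat p) \<in> H" using insert.prems \<open>S \<subseteq> H\<close> by (auto simp: S_def)
    then have "c (nat p) \<otimes> x \<in> H" "h (c (nat p) \<otimes> x) = sym_diff {p} P"
      using x insert.prems by (auto simp: subgroup.m_closed[OF H] h_mult h_c)
    then show ?case using insert.hyps by (intro bexI[of _ "c (nat p) \<otimes> x"]) auto
  qed
  then have "Pow {0..int r} \<subseteq> h ` H" by blast
  moreover have "finite (h ` H)" "card (h ` H) \<le> 2 ^ card T"
    using card_sym_diff_image_generate[OF T(2), of h] T(1,4) Hc h_mult by auto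
  ultimately have "card (Pow {0..int r}) \<le> 2 ^ card T"
    using card_mono[of "h ` H" "Pow {0..int r}"] by linarith
  then have "(2::nat) ^ (r + 1) \<le> 2 ^ card T" by (simp add: card_Pow nat_add_distrib)
  then have "r + 1 \<le> card T" by (rule power_le_imp_le_exp[rotated]) simp
  then show False using T(3) by simp
qed

end

section \<open>Torsion and metabelian groups\<close>

text \<open>Both properties pass to subgroups, although the elements \<open>s\<^sub>i\<close> to which traces and supports refer
  need not belong to the subgroup.\<close>

locale traced_dihedral_coordinates = dihedral_coordinates +
  assumes traced: "x \<in> carrier G \<Longrightarrow> \<exists>E. parity_trace x E"
    and finitely_supported: "x \<in> carrier G \<Longrightarrow> \<exists>F. supported x F"
begin

text \<open>A trace of an element of height zero has an even number of elements. If it is nonempty, then in the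
  level given by its diameter the two extreme indices meet in one position and produce a nontrivial
  translation, which has infinite order.\<close>

lemma torsion_free_coordinates: "torsion_free G"
  unfolding torsion_free_def
proof (intro ballI allI impI)
  fix x and q :: nat assume x: "x \<in> carrier G" and q: "0 < q" and xq: "x [^] q = \<one>"
  have shift: "shift x = 0" using shift_nat_pow[OF x, of q] xq q by simp
  have height: "height x = 0" using height_nat_pow[OF x, of q] xq q by simp
  have disp0: "disp x n j = 0" if "orient x n j = 1" for n j
    using translation_nat_pow[OF x shift that, of q] xq q by simp
  from traced[OF x] obtain E where E: "parity_trace x E" by blast
  have "E = {}"
  proof (rule ccontr)
    assume "E \<noteq> {}"
    note fin = parity_traceD(1)[OF E]
    have "even (card E)" using parity_traceD(2)[OF E] height by simp
    have "Min E \<noteq> Max E"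
    proof
      assume "Min E = Max E"
      then have "i = Max E" if "i \<in> E" for i
        using Min_le[OF fin that] Max_ge[OF fin that] by simp
      then obtain i where "E = {i}" using \<open>E \<noteq> {}\<close> by blast
      then show False using \<open>even (card E)\<close> by simp
    qed
    have in_E: "Min E \<in> E" "Max E \<in> E" using fin \<open>E \<noteq> {}\<close> by simp_all
    have range: "Min E \<le> i" "i \<le> Max E" if "i \<in> E" for i using fin that by simp_all
    define n where "n = nat (Max E - Min E)"
    have n: "1 \<le> n" "int n = Max E - Min E"
      using \<open>Min E \<noteq> Max E\<close> range(1)[OF in_E(2)] by (auto simp: n_def)
    have 1: "hits E n (Max E + 1) = {Max E}"
    proof (rule hits_single[OF in_E(2)])
      fix i assume "i \<in> E"
      from range[OF this] show "\<bar>i - Max E\<bar> < int (k n)" using n(2) long_cycles[OF n(1)] by linarith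
    qed
    have 2: "hits E n (Min E + 1) = {Min E}"
    proof (rule hits_single[OF in_E(1)])
      fix i assume "i \<in> E"
      from range[OF this] show "\<bar>i - Min E\<bar> < int (k n)" using n(2) long_cycles[OF n(1)] by linarith
    qed
    have 3: "Max E + 1 - int n = Min E + 1" using n by simp
    have "orient x n (Max E + 1) = 1" "odd (disp x n (Max E + 1))"
      using parity_traceD(3,4)[OF E n(1), of "Max E + 1"] orient_cases[OF x, of n "Max E + 1"]
      unfolding 1 2 3 by simp_all
    then show False using disp0 by fastforce
  qed
  then have "orient x n j = 1" if "1 \<le> n" for n j
    using parity_traceD(3)[OF E that, of j] orient_cases[OF x, of n j] by (auto simp: hits_def)
  then show "x = \<one>"
    using x shift height disp0 by (intro coordinates_eqI) auto
qed

text \<open>In each case it suffices that any two of the finitely many generators commute in all large levels.\<close>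

lemma virtually_abelian_if_metabelian:
  assumes "finitely_generated G" "metabelian G"
  shows "virtually_abelian G"
proof -
  obtain S where S: "S \<subseteq> carrier G" "finite S" "generate G S = carrier G"
    using assms(1) unfolding finitely_generated_def by blast
  show ?thesis
  proof (cases "\<forall>x\<in>carrier G. shift x = 0")
    case True
    have "\<forall>x\<in>S. \<exists>F. supported x F" using S(1) finitely_supported by blast
    then obtain F where F: "\<And>x. x \<in> S \<Longrightarrow> supported x (F x)" by metis
    have "supported x (\<Union>(F ` S))" if "x \<in> S" for x
      using supported_mono[OF F[OF that]] that S(2) supportedD(1)[OF F] by blast
    then have "\<forall>x\<in>S. \<forall>y\<in>S. \<forall>\<^sub>F n in sequentially. same_at n (x \<otimes> y) (y \<otimes> x)"
      using S(1) True by (intro ballI eventually_commute_supported) auto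
    then show ?thesis
      using S by (intro virtually_abelianI[OF S(1,3)]) (simp add: eventually_ball_finite_distrib)
  next
    case False
    then obtain g1 where "g1 \<in> carrier G" "shift g1 \<noteq> 0" by blast
    then have "\<exists>g\<in>carrier G. shift g > 0"
      by (cases "shift g1 > 0") (auto intro: bexI[of _ "inv g1"])
    then have "\<exists>m. \<exists>g\<in>carrier G. shift g > 0 \<and> nat (shift g) = m" by blast
    then obtain g where g: "g \<in> carrier G" "shift g > 0"
      and least: "\<And>y. y \<in> carrier G \<Longrightarrow> shift y > 0 \<Longrightarrow> nat (shift g) \<le> nat (shift y)"
      using exists_least_iff[of "\<lambda>m. \<exists>g\<in>carrier G. shift g > 0 \<and> nat (shift g) = m"]
      by (metis not_le)
    \<comment> \<open>As \<open>shift g\<close> is minimal, \<open>e x\<close> is the power of \<open>g\<close> with the same shift as \<open>x\<close>.\<close>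
    define e where "e x = g [^] (shift x div shift g)" for x
    have e: "e x \<in> carrier G" "e x \<otimes> e y = e y \<otimes> e x" for x y
      using g by (simp_all add: e_def add.commute flip: int_pow_mult)
    have "\<forall>\<^sub>F n in sequentially. same_at n x (e x)" if "x \<in> carrier G" for x
    proof -
      define u where "u = x \<otimes> inv (e x)"
      have u: "u \<in> carrier G" and x: "x = u \<otimes> e x"
        using that e(1) by (simp_all add: u_def m_assoc)
      have "shift u = shift x mod shift g"
        using that g e(1) by (simp add: u_def shift_mult) (simp add: e_def shift_int_pow minus_div_mult_eq_mod)
      then have "shift u = 0"
        using least[OF u] g(2) pos_mod_bound[OF g(2), of "shift x"] pos_mod_sign[OF g(2), of "shift x"]
        by linarith
      obtain E F where E: "parity_trace u E" and F: "supported u F"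
        using traced[OF u] finitely_supported[OF u] by blast
      have "E = {}"
        using not_metabelian_if_trace[OF g u \<open>shift u = 0\<close> E] assms(2) by blast
      then have "\<forall>\<^sub>F n in sequentially. same_at n u \<one>"
        using eventually_trivial_if_no_trace[OF u \<open>shift u = 0\<close> _ F] E by simp
      then show ?thesis
      proof eventually_elim
        case (elim n)
        then have "same_at n (u \<otimes> e x) (\<one> \<otimes> e x)"
          using u e(1) by (intro same_at_mult same_at_refl) auto
        then show ?case using x e(1) by simp
      qed
    qed
    then have "\<forall>\<^sub>F n in sequentially. \<forall>x\<in>S. same_at n x (e x)"
      using S(1,2) by (intro eventually_ball_finite) auto
    then have "\<forall>\<^sub>F n in sequentially. \<forall>x\<in>S. \<forall>y\<in>S. same_at n (x \<otimes> y) (y \<otimes> x)"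
    proof eventually_elim
      case (elim n)
      show ?case
      proof (intro ballI)
        fix x y assume xy: "x \<in> S" "y \<in> S"
        then have car: "x \<in> carrier G" "y \<in> carrier G" using S(1) by auto
        have "same_at n (x \<otimes> y) (e x \<otimes> e y)"
          using elim xy car e(1) by (intro same_at_mult) auto
        also have "e x \<otimes> e y = e y \<otimes> e x" by (rule e(2))
        also have "same_at n (e y \<otimes> e x) (y \<otimes> x)"
          using elim xy car e(1) by (intro same_at_sym[OF same_at_mult]) auto
        finally show "same_at n (x \<otimes> y) (y \<otimes> x)" .
      qed
    qed
    then show ?thesis by (rule virtually_abelianI[OF S(1,3)])
  qed
qed

end

section \<open>Presented groups\<close>

lemma pres_class_eq_iff: "pres_class R u = pres_class R v \<longleftrightarrow> pres_eq R u v"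
  unfolding pres_class_def by (auto intro: pres_eq.intros)

lemma pres_class_mult:
  "pres_class R u \<otimes>\<^bsub>presented_group R\<^esub> pres_class R v = pres_class R (u @ v)"
proof -
  have "pres_eq R (u' @ v') w \<longleftrightarrow> pres_eq R (u @ v) w" if "pres_eq R u u'" "pres_eq R v v'" for u' v' w
    using pres_eq.append[OF that] by (blast intro: pres_eq.sym pres_eq.trans)
  then show ?thesis
    by (auto simp: presented_group_def pres_class_def intro: pres_eq.refl)
qed

text \<open>A word preceded by its formal inverse cancels from the inside out.\<close>

lemma pres_eq_inverse_word:
  "pres_eq R (rev (map (\<lambda>(x, e). (x, \<not> e)) w) @ w) []"
proof (induction w)
  case Nil
  show ?case by (simp add: pres_eq.refl)
next
  case (Cons l w)
  obtain x e where l: "l = (x, e)" by (cases l)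
  let ?u = "rev (map (\<lambda>(x, e). (x, \<not> e)) w)"
  have "pres_eq R ([(x, \<not> e), (x, e)] @ w) ([] @ w)"
    using pres_eq.cancel[of R x "\<not> e"] by (intro pres_eq.append pres_eq.refl) simp
  then have "pres_eq R (?u @ ([(x, \<not> e), (x, e)] @ w)) (?u @ ([] @ w))"
    by (rule pres_eq.append[OF pres_eq.refl])
  then show ?case using pres_eq.trans[OF _ Cons.IH] by (simp add: l)
qed

lemma group_presented_group: "group (presented_group R)"
proof (rule groupI)
  show "\<one>\<^bsub>presented_group R\<^esub> \<in> carrier (presented_group R)"
    by (simp add: presented_group_def)
next
  fix U assume "U \<in> carrier (presented_group R)"
  then obtain u where u: "U = pres_class R u" by (auto simp: presented_group_def)
  have one: "\<one>\<^bsub>presented_group R\<^esub> = pres_class R []" by (simp add: presented_group_def)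
  show "\<one>\<^bsub>presented_group R\<^esub> \<otimes>\<^bsub>presented_group R\<^esub> U = U"
    by (simp add: u one pres_class_mult)
  show "\<exists>V\<in>carrier (presented_group R). V \<otimes>\<^bsub>presented_group R\<^esub> U = \<one>\<^bsub>presented_group R\<^esub>"
  proof
    show "pres_class R (rev (map (\<lambda>(x, e). (x, \<not> e)) u)) \<otimes>\<^bsub>presented_group R\<^esub> U
      = \<one>\<^bsub>presented_group R\<^esub>"
      by (simp only: u one pres_class_mult pres_class_eq_iff pres_eq_inverse_word)
  qed (simp add: presented_group_def)
next
  fix U V assume "U \<in> carrier (presented_group R)" "V \<in> carrier (presented_group R)"
  then obtain u v where uv: "U = pres_class R u" "V = pres_class R v"
    by (auto simp: presented_group_def)
  show "U \<otimes>\<^bsub>presented_group R\<^esub> V \<in> carrier (presented_group R)"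
    unfolding uv pres_class_mult by (simp add: presented_group_def)
  fix W assume "W \<in> carrier (presented_group R)"
  then obtain w where w: "W = pres_class R w" by (auto simp: presented_group_def)
  show "U \<otimes>\<^bsub>presented_group R\<^esub> V \<otimes>\<^bsub>presented_group R\<^esub> W
    = U \<otimes>\<^bsub>presented_group R\<^esub> (V \<otimes>\<^bsub>presented_group R\<^esub> W)"
    unfolding uv w pres_class_mult by simp
qed

section \<open>The infinite dihedral group acting on the integers\<close>

fun word_sign :: "dih_gen word \<Rightarrow> int" where
  "word_sign [] = 1"
| "word_sign (l # w) = - word_sign w"

text \<open>The word acts on the integers as \<open>v \<mapsto> word_disp w + word_sign w * v\<close>, where \<open>a\<close> and \<open>b\<close>, as well as their
  formal inverses, are the reflections \<open>v \<mapsto> - v\<close> and \<open>v \<mapsto> 1 - v\<close>.\<close>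

fun word_disp :: "dih_gen word \<Rightarrow> int" where
  "word_disp [] = 0"
| "word_disp ((x, e) # w) = (if x = Gen_b then 1 else 0) - word_disp w"

lemma word_sign_append: "word_sign (u @ v) = word_sign u * word_sign v"
  by (induction u) auto

lemma word_disp_append: "word_disp (u @ v) = word_disp u + word_sign u * word_disp v"
  by (induction u rule: word_disp.induct) auto

lemma word_sign_cases: "word_sign w = 1 \<or> word_sign w = - 1"
  by (induction w) auto

lemma pres_eq_imp_same_action:
  "pres_eq dih_relators u v \<Longrightarrow> word_sign u = word_sign v \<and> word_disp u = word_disp v"
  by (induction rule: pres_eq.induct)
    (auto simp: word_sign_append word_disp_append dih_relators_def)

fun other_gen :: "dih_gen \<Rightarrow> dih_gen" where
  "other_gen Gen_a = Gen_b"
| "other_gen Gen_b = Gen_a"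

fun alternating_word :: "dih_gen \<Rightarrow> nat \<Rightarrow> dih_gen word" where
  "alternating_word x 0 = []"
| "alternating_word x (Suc n) = (x, True) # alternating_word (other_gen x) n"

lemma pres_eq_letter_True: "pres_eq dih_relators [(x, e)] [(x, True)]"
proof (cases e)
  case False
  have rel: "[(x, True), (x, True)] \<in> dih_relators" by (cases x) (auto simp: dih_relators_def)
  have "pres_eq dih_relators ([(x, False)] @ [(x, True), (x, True)]) ([(x, False)] @ [])"
    by (intro pres_eq.append pres_eq.refl pres_eq.relator rel)
  moreover have "pres_eq dih_relators ([(x, False), (x, True)] @ [(x, True)]) ([] @ [(x, True)])"
    using pres_eq.cancel[of dih_relators x False] by (intro pres_eq.append pres_eq.refl) simp
  ultimately show ?thesis
    using False by (auto intro: pres_eq.sym pres_eq.trans)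
qed (auto intro: pres_eq.refl)

text \<open>Modulo the relators every letter is its own inverse, and adjacent equal letters cancel.\<close>

lemma pres_eq_alternating_word: "\<exists>x n. pres_eq dih_relators w (alternating_word x n)"
proof (induction w)
  case Nil
  have "pres_eq dih_relators [] (alternating_word Gen_a 0)" by (simp add: pres_eq.refl)
  then show ?case by blast
next
  case (Cons l w)
  obtain y e where l: "l = (y, e)" by (cases l)
  from Cons.IH obtain x n where w: "pres_eq dih_relators w (alternating_word x n)" by blast
  have red: "pres_eq dih_relators (l # w) ((y, True) # alternating_word x n)"
    using pres_eq.append[OF pres_eq_letter_True[of y e] w] by (simp add: l)
  show ?case
  proof (cases n)
    case 0
    then have "(y, True) # alternating_word x n = alternating_word y 1" by simp
    then show ?thesis using red by metis
  next
    case (Suc m)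
    show ?thesis
    proof (cases "x = y")
      case True
      have rel: "[(y, True), (y, True)] \<in> dih_relators" by (cases y) (auto simp: dih_relators_def)
      have "pres_eq dih_relators ([(y, True), (y, True)] @ alternating_word (other_gen y) m)
        ([] @ alternating_word (other_gen y) m)"
        by (intro pres_eq.append pres_eq.refl pres_eq.relator rel)
      then have "pres_eq dih_relators (l # w) (alternating_word (other_gen y) m)"
        using pres_eq.trans[OF red] Suc True by simp
      then show ?thesis by blast
    next
      case False
      then have "x = other_gen y" by (cases x; cases y) auto
      then have "(y, True) # alternating_word x n = alternating_word y (Suc n)" by simp
      then show ?thesis using red by metis
    qed
  qed
qed

lemma word_sign_alternating: "word_sign (alternating_word x n) = (if even n then 1 else - 1)"
  by (induction n arbitrary: x) auto

lemma word_disp_alternating: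
  "word_disp (alternating_word x n) = (if x = Gen_b then (int n + 1) div 2 else - (int n div 2))"
proof (induction n arbitrary: x)
  case (Suc n)
  then show ?case by (cases x) (auto simp: add.commute)
qed simp

text \<open>The action is faithful because alternating words act differently: the sign of the action gives the
  parity of the length, and the displacement, which is positive exactly for words that begin with
  \<open>b\<close> and at most \<open>0\<close> for those that begin with \<open>a\<close>, then gives the first letter and the length.\<close>

lemma same_action_imp_pres_eq:
  assumes "word_sign u = word_sign v" "word_disp u = word_disp v"
  shows "pres_eq dih_relators u v"
proof -
  obtain x m where u: "pres_eq dih_relators u (alternating_word x m)"
    using pres_eq_alternating_word by blast
  obtain y n where v: "pres_eq dih_relators v (alternating_word y n)"
    using pres_eq_alternating_word by blast
  have "even m = even n"
    using assms(1) pres_eq_imp_same_action[OF u] pres_eq_imp_same_action[OF v]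
    by (auto simp: word_sign_alternating split: if_splits)
  then obtain i j e :: nat where mn: "m = 2 * i + e" "n = 2 * j + e" "e = 0 \<or> e = 1"
    using that[of "m div 2" "m mod 2" "n div 2"] by (simp add: mod2_eq_if minus_mod_eq_mult_div)
  have "(if x = Gen_b then (int m + 1) div 2 else - (int m div 2))
      = (if y = Gen_b then (int n + 1) div 2 else - (int n div 2))"
    using assms(2) pres_eq_imp_same_action[OF u] pres_eq_imp_same_action[OF v]
    by (simp add: word_disp_alternating)
  then have "m = n \<and> (m = 0 \<or> x = y)"
    using mn by (cases x; cases y) auto
  then have "alternating_word x m = alternating_word y n" by auto
  then show ?thesis using u v by (metis pres_eq.sym pres_eq.trans)
qed

text \<open>Any representative may be chosen, by lemma \<open>pres_eq_imp_same_action\<close>.\<close>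

definition class_sign :: "dih_gen word set \<Rightarrow> int" where
  "class_sign U = word_sign (SOME w. w \<in> U)"

definition class_disp :: "dih_gen word set \<Rightarrow> int" where
  "class_disp U = word_disp (SOME w. w \<in> U)"

lemma class_action [simp]:
  "class_sign (pres_class dih_relators w) = word_sign w"
  "class_disp (pres_class dih_relators w) = word_disp w"
proof -
  have "w \<in> pres_class dih_relators w" by (simp add: pres_class_def pres_eq.refl)
  then have "(SOME v. v \<in> pres_class dih_relators w) \<in> pres_class dih_relators w"
    by (rule someI)
  then have "pres_eq dih_relators w (SOME v. v \<in> pres_class dih_relators w)"
    unfolding pres_class_def by simp
  from pres_eq_imp_same_action[OF this]
  show "class_sign (pres_class dih_relators w) = word_sign w"
    "class_disp (pres_class dih_relators w) = word_disp w"
    by (simp_all add: class_sign_def class_disp_def)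
qed

lemma group_D_inf [simp]: "group D_inf"
  unfolding D_inf_def by (rule group_presented_group)

lemma D_inf_cases:
  assumes "U \<in> carrier D_inf"
  obtains w where "U = pres_class dih_relators w"
  using assms by (auto simp: D_inf_def presented_group_def)

lemma pres_class_in_D_inf [simp]: "pres_class dih_relators w \<in> carrier D_inf"
  by (simp add: D_inf_def presented_group_def)

lemma class_sign_mult:
  "\<lbrakk>U \<in> carrier D_inf; V \<in> carrier D_inf\<rbrakk>
    \<Longrightarrow> class_sign (U \<otimes>\<^bsub>D_inf\<^esub> V) = class_sign U * class_sign V"
  by (elim D_inf_cases) (simp add: D_inf_def pres_class_mult word_sign_append)

lemma class_disp_mult:
  "\<lbrakk>U \<in> carrier D_inf; V \<in> carrier D_inf\<rbrakk>
    \<Longrightarrow> class_disp (U \<otimes>\<^bsub>D_inf\<^esub> V) = class_disp U + class_sign U * class_disp V"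
  by (elim D_inf_cases) (simp add: D_inf_def pres_class_mult word_disp_append)

lemma class_sign_cases: "U \<in> carrier D_inf \<Longrightarrow> class_sign U = 1 \<or> class_sign U = - 1"
  by (elim D_inf_cases) (simp add: word_sign_cases)

lemma D_inf_eqI:
  "\<lbrakk>U \<in> carrier D_inf; V \<in> carrier D_inf; class_sign U = class_sign V; class_disp U = class_disp V\<rbrakk>
    \<Longrightarrow> U = V"
  by (elim D_inf_cases) (simp add: pres_class_eq_iff same_action_imp_pres_eq)

lemma class_one [simp]: "class_sign \<one>\<^bsub>D_inf\<^esub> = 1" "class_disp \<one>\<^bsub>D_inf\<^esub> = 0"
  by (simp_all add: D_inf_def presented_group_def)

lemma class_generators [simp]:
  "class_sign dih_a = - 1" "class_disp dih_a = 0" "class_sign dih_b = - 1" "class_disp dih_b = 1"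
  by (simp_all add: dih_a_def dih_b_def)

lemma dih_a_b_in_D_inf [simp]: "dih_a \<in> carrier D_inf" "dih_b \<in> carrier D_inf"
  by (simp_all add: dih_a_def dih_b_def)

section \<open>The wreath products and their product\<close>

lemma group_semidirect:
  assumes "group N" "group Q"
    and closed: "\<And>p x. \<lbrakk>p \<in> carrier Q; x \<in> carrier N\<rbrakk> \<Longrightarrow> \<phi> p x \<in> carrier N"
    and mult: "\<And>p x y. \<lbrakk>p \<in> carrier Q; x \<in> carrier N; y \<in> carrier N\<rbrakk>
      \<Longrightarrow> \<phi> p (x \<otimes>\<^bsub>N\<^esub> y) = \<phi> p x \<otimes>\<^bsub>N\<^esub> \<phi> p y"
    and comp: "\<And>p q x. \<lbrakk>p \<in> carrier Q; q \<in> carrier Q; x \<in> carrier N\<rbrakk>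
      \<Longrightarrow> \<phi> (p \<otimes>\<^bsub>Q\<^esub> q) x = \<phi> p (\<phi> q x)"
    and unit: "\<And>x. x \<in> carrier N \<Longrightarrow> \<phi> \<one>\<^bsub>Q\<^esub> x = x"
  shows "group (semidirect N Q \<phi>)"
proof -
  interpret N: group N by fact
  interpret Q: group Q by fact
  have map_one: "\<phi> p \<one>\<^bsub>N\<^esub> = \<one>\<^bsub>N\<^esub>" if "p \<in> carrier Q" for p
    using mult[OF that N.one_closed N.one_closed] closed[OF that N.one_closed] by simp
  show ?thesis
  proof (rule groupI)
    fix U assume "U \<in> carrier (semidirect N Q \<phi>)"
    then obtain x p where U: "U = (x, p)" "x \<in> carrier N" "p \<in> carrier Q"
      by (auto simp: semidirect_def)
    show "\<exists>V\<in>carrier (semidirect N Q \<phi>). V \<otimes>\<^bsub>semidirect N Q \<phi>\<^esub> U = \<one>\<^bsub>semidirect N Q \<phi>\<^esub>"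
      using U closed map_one
      by (intro bexI[of _ "(\<phi> (inv\<^bsub>Q\<^esub> p) (inv\<^bsub>N\<^esub> x), inv\<^bsub>Q\<^esub> p)"])
        (simp_all add: semidirect_def flip: mult)
  qed (auto simp: semidirect_def closed mult comp unit N.m_assoc Q.m_assoc)
qed

lemma group_dih_power [simp]: "group (dih_power m)"
  by (simp add: dih_power_def)

lemma cyc_shift_index:
  "0 < m \<Longrightarrow> (j - c - 1) mod int m + 1 \<in> {1..int m}"
  unfolding atLeastAtMost_iff
  using pos_mod_bound[of "int m" "j - c - 1"] pos_mod_sign[of "int m" "j - c - 1"] by linarith

lemma group_H_group [simp]:
  assumes "0 < m"
  shows "group (H_group m)"
  unfolding H_group_def
proof (rule group_semidirect)
  fix p q and f g :: "int \<Rightarrow> dih_gen word set"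
  assume f: "f \<in> carrier (dih_power m)"
  note index = cyc_shift_index[OF assms]
  show "cyc_shift m p f \<in> carrier (dih_power m)"
    using f index by (auto simp: dih_power_def cyc_shift_def PiE_iff)
  show "cyc_shift m p (f \<otimes>\<^bsub>dih_power m\<^esub> g)
    = cyc_shift m p f \<otimes>\<^bsub>dih_power m\<^esub> cyc_shift m p g"
    using index by (auto simp: dih_power_def cyc_shift_def fun_eq_iff restrict_def)
  show "cyc_shift m (p \<otimes>\<^bsub>integer_mod_group m\<^esub> q) f = cyc_shift m p (cyc_shift m q f)"
  proof -
    have "(j - (p + q) mod int m - 1) mod int m = (j - (p + q) - 1) mod int m" for j
      by (intro mod_diff_cong) simp_all
    moreover have "((j - p - 1) mod int m + 1 - q - 1) mod int m = (j - p - 1 + 1 - q - 1) mod int m" for j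
      by (intro mod_diff_cong mod_add_cong) simp_all
    moreover have "j - p - 1 + 1 - q - 1 = j - (p + q) - 1" for j by simp
    ultimately have "(j - (p + q) mod int m - 1) mod int m
      = ((j - p - 1) mod int m + 1 - q - 1) mod int m" for j
      by metis
    then show ?thesis
      using index by (auto simp: cyc_shift_def fun_eq_iff restrict_def)
  qed
  show "cyc_shift m \<one>\<^bsub>integer_mod_group m\<^esub> f = f"
  proof
    fix j
    show "cyc_shift m \<one>\<^bsub>integer_mod_group m\<^esub> f j = f j"
      using f by (cases "j \<in> {1..int m}") (auto simp: cyc_shift_def dih_power_def PiE_iff extensional_def)
  qed
qed simp_all

lemma group_Delta:
  assumes "\<And>n. 1 \<le> n \<Longrightarrow> 0 < k n"
  shows "group (Delta k)"
  unfolding Delta_def using assms by (intro DirProd_group product_group) auto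

section \<open>Coordinates on the construction\<close>

lemma (in traced_dihedral_coordinates) traced_subgroup:
  assumes "subgroup K G"
  shows "traced_dihedral_coordinates (G\<lparr>carrier := K\<rparr>) k shift height orient disp"
proof -
  have K: "x \<in> carrier G" if "x \<in> K" for x using subgroup.mem_carrier[OF assms that] .
  interpret K: group "G\<lparr>carrier := K\<rparr>" using subgroup_imp_group[OF assms] .
  interpret K: dihedral_coordinates "G\<lparr>carrier := K\<rparr>" k shift height orient disp
    by unfold_locales
      (use K long_cycles orient_cases in \<open>auto intro: coordinates_eqI orient_periodic disp_periodic
        simp: shift_mult height_mult orient_mult disp_mult\<close>)
  show ?thesis
    by unfold_locales (use traced finitely_supported K in auto)
qed

text \<open>The representative of \<open>j\<close> modulo \<open>k n\<close> in \<open>{1..k n}\<close>.\<close>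

definition index_mod :: "(nat \<Rightarrow> nat) \<Rightarrow> nat \<Rightarrow> int \<Rightarrow> int" where
  "index_mod k n j = (j - 1) mod int (k n) + 1"

definition entry ::
    "(nat \<Rightarrow> nat) \<Rightarrow> int \<times> (nat \<Rightarrow> H_elem) \<Rightarrow> nat \<Rightarrow> int \<Rightarrow> dih_gen word set" where
  "entry k x n j = fst (snd x n) (index_mod k n j)"

text \<open>The component of \<open>x\<close> in the cyclic group of level \<open>n\<close> is the class of one integer \<open>m\<close>, the same for
  all levels. This holds for \<open>t\<close> with \<open>m = 1\<close> and for \<open>s\<close> with \<open>m = 0\<close>, hence on the group that they
  generate, but not on the whole product.\<close>

definition has_rotation :: "(nat \<Rightarrow> nat) \<Rightarrow> int \<times> (nat \<Rightarrow> H_elem) \<Rightarrow> int \<Rightarrow> bool" where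
  "has_rotation k x m \<longleftrightarrow> (\<forall>n\<ge>1. snd (snd x n) = m mod int (k n))"

definition rotation :: "(nat \<Rightarrow> nat) \<Rightarrow> int \<times> (nat \<Rightarrow> H_elem) \<Rightarrow> int" where
  "rotation k x = (THE m. has_rotation k x m)"

text \<open>The product has no level \<open>0\<close>; the value \<open>1\<close> there makes the multiplication law valid for all \<open>n\<close>.\<close>

definition entry_sign ::
    "(nat \<Rightarrow> nat) \<Rightarrow> int \<times> (nat \<Rightarrow> H_elem) \<Rightarrow> nat \<Rightarrow> int \<Rightarrow> int" where
  "entry_sign k x n j = (if n = 0 then 1 else class_sign (entry k x n j))"

definition entry_disp ::
    "(nat \<Rightarrow> nat) \<Rightarrow> int \<times> (nat \<Rightarrow> H_elem) \<Rightarrow> nat \<Rightarrow> int \<Rightarrow> int" where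
  "entry_disp k x n j = (if n = 0 then 0 else class_disp (entry k x n j))"

locale long_cycle_lengths =
  fixes k :: "nat \<Rightarrow> nat"
  assumes long: "1 \<le> n \<Longrightarrow> 2 * n + 2 \<le> k n"
begin

lemma k_pos: "1 \<le> n \<Longrightarrow> 0 < k n"
  using long[of n] by simp

lemma group_Delta_k: "group (Delta k)"
  by (rule group_Delta[OF k_pos])

lemma Delta_component:
  assumes "x \<in> carrier (Delta k)" "1 \<le> n"
  shows "fst (snd x n) \<in> carrier (dih_power (k n))" "snd (snd x n) \<in> {0..<int (k n)}"
proof -
  have "snd x n \<in> carrier (H_group (k n))"
    using assms by (auto simp: Delta_def DirProd_def PiE_iff)
  then show "fst (snd x n) \<in> carrier (dih_power (k n))" "snd (snd x n) \<in> {0..<int (k n)}"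
    using k_pos[OF assms(2)] by (auto simp: H_group_def semidirect_def carrier_integer_mod_group)
qed

lemma fst_Delta_mult: "fst (x \<otimes>\<^bsub>Delta k\<^esub> y) = fst x + fst y"
  by (simp add: Delta_def DirProd_def case_prod_unfold)

lemma snd_Delta_mult:
  assumes "1 \<le> n"
  shows "snd (x \<otimes>\<^bsub>Delta k\<^esub> y) n =
    (fst (snd x n) \<otimes>\<^bsub>dih_power (k n)\<^esub> cyc_shift (k n) (snd (snd x n)) (fst (snd y n)),
     (snd (snd x n) + snd (snd y n)) mod int (k n))"
  using assms by (simp add: Delta_def DirProd_def case_prod_unfold H_group_def semidirect_def)

lemma index_mod_range: "1 \<le> n \<Longrightarrow> index_mod k n j \<in> {1..int (k n)}"
  unfolding index_mod_def using cyc_shift_index[OF k_pos, of n j 0] by simp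

lemma entry_in_D_inf:
  "\<lbrakk>x \<in> carrier (Delta k); 1 \<le> n\<rbrakk> \<Longrightarrow> entry k x n j \<in> carrier D_inf"
  using Delta_component(1)[of x n] index_mod_range[of n j]
  by (auto simp: entry_def dih_power_def PiE_iff)

text \<open>Extending the entries periodically to all integers turns the cyclic shift by the class of \<open>m\<close> into
  the translation of positions by \<open>m\<close>.\<close>

lemma entry_mult:
  assumes "has_rotation k x m" "1 \<le> n"
  shows "entry k (x \<otimes>\<^bsub>Delta k\<^esub> y) n j = entry k x n j \<otimes>\<^bsub>D_inf\<^esub> entry k y n (j - m)"
proof -
  have "(index_mod k n j - m mod int (k n) - 1) mod int (k n)
      = ((j - 1) mod int (k n) + 1 - m mod int (k n) - 1) mod int (k n)"
    by (simp add: index_mod_def)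
  also have "\<dots> = (j - 1 + 1 - m - 1) mod int (k n)"
    by (intro mod_diff_cong mod_add_cong) simp_all
  finally have "(index_mod k n j - snd (snd x n) - 1) mod int (k n) + 1 = index_mod k n (j - m)"
    using assms by (simp add: has_rotation_def index_mod_def)
  then show ?thesis
    using index_mod_range[OF assms(2), of j] assms(2)
    by (simp add: entry_def snd_Delta_mult dih_power_def cyc_shift_def)
qed

lemma has_rotation_mult:
  "\<lbrakk>has_rotation k x m; has_rotation k y m'\<rbrakk> \<Longrightarrow> has_rotation k (x \<otimes>\<^bsub>Delta k\<^esub> y) (m + m')"
  by (simp add: has_rotation_def snd_Delta_mult mod_simps)

lemma has_rotation_one: "has_rotation k \<one>\<^bsub>Delta k\<^esub> 0"
  by (simp add: has_rotation_def Delta_def DirProd_def H_group_def semidirect_def)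

text \<open>Some \<open>k n\<close> exceeds the distance of the two integers.\<close>

lemma has_rotation_unique:
  assumes "has_rotation k x m" "has_rotation k x m'"
  shows "m = m'"
proof -
  define n where "n = nat \<bar>m - m'\<bar> + 1"
  have n: "1 \<le> n" "\<bar>m - m'\<bar> < int (k n)" using long[of n] by (auto simp: n_def)
  have "m mod int (k n) = m' mod int (k n)"
    using assms n(1) unfolding has_rotation_def by metis
  then show ?thesis using int_mod_eq_iff_close[OF n(2)] by blast
qed

lemma rotation_eq: "has_rotation k x m \<Longrightarrow> rotation k x = m"
  unfolding rotation_def using has_rotation_unique by blast

lemma Delta_eqI:
  assumes "x \<in> carrier (Delta k)" "y \<in> carrier (Delta k)" "fst x = fst y"
    and "has_rotation k x m" "has_rotation k y m"
    and "\<And>n j. 1 \<le> n \<Longrightarrow> entry k x n j = entry k y n j"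
  shows "x = y"
proof (rule prod_eqI[OF assms(3)], rule ext)
  fix n
  show "snd x n = snd y n"
  proof (cases "1 \<le> n")
    case False
    then show ?thesis
      using assms(1,2) by (auto simp: Delta_def DirProd_def PiE_iff extensional_def)
  next
    case True
    have "fst (snd x n) j = fst (snd y n) j" for j
    proof (cases "j \<in> {1..int (k n)}")
      case j: True
      then have "index_mod k n j = j" by (simp add: index_mod_def)
      then show ?thesis using assms(6)[OF True, of j] by (simp add: entry_def)
    next
      case False
      then show ?thesis
        using Delta_component(1)[OF assms(1) True] Delta_component(1)[OF assms(2) True]
        by (simp add: dih_power_def PiE_iff extensional_def)
    qed
    moreover have "snd (snd x n) = snd (snd y n)"
      using assms(4,5) True by (simp add: has_rotation_def)
    ultimately show ?thesis by (intro prod_eqI ext) auto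
  qed
qed

definition rotated_subgroup :: "(int \<times> (nat \<Rightarrow> H_elem)) set" where
  "rotated_subgroup = {x \<in> carrier (Delta k). \<exists>m. has_rotation k x m}"

lemma subgroup_rotated: "subgroup rotated_subgroup (Delta k)"
proof -
  interpret group "Delta k" by (rule group_Delta_k)
  show ?thesis
  proof (rule subgroup.intro)
    fix x assume x: "x \<in> rotated_subgroup"
    then obtain m where m: "x \<in> carrier (Delta k)" "has_rotation k x m"
      by (auto simp: rotated_subgroup_def)
    have "snd (snd (inv\<^bsub>Delta k\<^esub> x) n) = (- m) mod int (k n)" if n: "1 \<le> n" for n
    proof -
      let ?i = "snd (snd (inv\<^bsub>Delta k\<^esub> x) n)"
      have "snd (snd \<one>\<^bsub>Delta k\<^esub> n) = (m mod int (k n) + ?i) mod int (k n)"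
        using snd_Delta_mult[OF n, of x "inv\<^bsub>Delta k\<^esub> x"] m n
        by (simp add: has_rotation_def)
      then have "(m + ?i) mod int (k n) = 0"
        using has_rotation_one n by (simp add: has_rotation_def mod_simps)
      then have "?i mod int (k n) = (- m) mod int (k n)"
        by (simp add: mod_eq_dvd_iff mod_eq_0_iff_dvd add.commute)
      then show ?thesis
        using Delta_component(2)[of "inv\<^bsub>Delta k\<^esub> x" n] m n by simp
    qed
    then show "inv\<^bsub>Delta k\<^esub> x \<in> rotated_subgroup"
      using m by (auto simp: rotated_subgroup_def has_rotation_def)
  next
    fix x y assume "x \<in> rotated_subgroup" "y \<in> rotated_subgroup"
    then show "x \<otimes>\<^bsub>Delta k\<^esub> y \<in> rotated_subgroup"
      unfolding rotated_subgroup_def using has_rotation_mult by blast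
  qed (use has_rotation_one in \<open>auto simp: rotated_subgroup_def\<close>)
qed

lemma dihedral_coordinates_rotated:
  assumes "subgroup H (Delta k)" "H \<subseteq> rotated_subgroup"
  shows "dihedral_coordinates ((Delta k)\<lparr>carrier := H\<rparr>) k
    (rotation k) fst (entry_sign k) (entry_disp k)"
proof -
  interpret H: group "(Delta k)\<lparr>carrier := H\<rparr>"
    by (rule group.subgroup_imp_group[OF group_Delta_k assms(1)])
  have H: "x \<in> carrier (Delta k)" "has_rotation k x (rotation k x)" if "x \<in> H" for x
  proof -
    have "x \<in> rotated_subgroup" using that assms(2) by blast
    then obtain m where "x \<in> carrier (Delta k)" "has_rotation k x m"
      by (auto simp: rotated_subgroup_def)
    then show "x \<in> carrier (Delta k)" "has_rotation k x (rotation k x)"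
      by (simp_all add: rotation_eq)
  qed
  show ?thesis
  proof unfold_locales
    fix n :: nat assume "1 \<le> n" then show "2 * n + 2 \<le> k n" by (rule long)
  next
    fix x y n and j :: int
    assume "x \<in> carrier ((Delta k)\<lparr>carrier := H\<rparr>)" "y \<in> carrier ((Delta k)\<lparr>carrier := H\<rparr>)"
    then have xy: "x \<in> H" "y \<in> H" by simp_all
    show "rotation k (x \<otimes>\<^bsub>(Delta k)\<lparr>carrier := H\<rparr>\<^esub> y) = rotation k x + rotation k y"
      using has_rotation_mult[OF H(2)[OF xy(1)] H(2)[OF xy(2)]] by (simp add: rotation_eq)
    show "fst (x \<otimes>\<^bsub>(Delta k)\<lparr>carrier := H\<rparr>\<^esub> y) = fst x + fst y"
      by (simp add: fst_Delta_mult)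
    have entries: "entry k x n i \<in> carrier D_inf" "entry k y n i \<in> carrier D_inf" if "n \<noteq> 0" for i
      using entry_in_D_inf H(1) xy that by simp_all
    show "entry_sign k (x \<otimes>\<^bsub>(Delta k)\<lparr>carrier := H\<rparr>\<^esub> y) n j
        = entry_sign k x n j * entry_sign k y n (j - rotation k x)"
      using entries
      by (auto simp: entry_sign_def entry_mult[OF H(2)[OF xy(1)]] class_sign_mult)
    show "entry_disp k (x \<otimes>\<^bsub>(Delta k)\<lparr>carrier := H\<rparr>\<^esub> y) n j
        = entry_disp k x n j + entry_sign k x n j * entry_disp k y n (j - rotation k x)"
      using entries
      by (auto simp: entry_disp_def entry_sign_def entry_mult[OF H(2)[OF xy(1)]] class_disp_mult)
    show "entry_sign k x n j = 1 \<or> entry_sign k x n j = - 1"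
      using entries class_sign_cases by (auto simp: entry_sign_def)
  next
    fix x n and j j' :: int assume "j mod int (k n) = j' mod int (k n)"
    then have "index_mod k n j = index_mod k n j'"
      unfolding index_mod_def by (metis mod_diff_left_eq)
    then show "entry_sign k x n j = entry_sign k x n j'" "entry_disp k x n j = entry_disp k x n j'"
      by (simp_all add: entry_sign_def entry_disp_def entry_def)
  next
    fix x y
    assume "x \<in> carrier ((Delta k)\<lparr>carrier := H\<rparr>)" "y \<in> carrier ((Delta k)\<lparr>carrier := H\<rparr>)"
      and rot: "rotation k x = rotation k y" and "fst x = fst y"
      and sign: "\<And>n j. 1 \<le> n \<Longrightarrow> entry_sign k x n j = entry_sign k y n j"
      and disp: "\<And>n j. 1 \<le> n \<Longrightarrow> entry_disp k x n j = entry_disp k y n j"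
    then have xy: "x \<in> H" "y \<in> H" by simp_all
    show "x = y"
    proof (rule Delta_eqI[OF H(1)[OF xy(1)] H(1)[OF xy(2)] \<open>fst x = fst y\<close> H(2)[OF xy(1)]])
      show "has_rotation k y (rotation k x)" using H(2)[OF xy(2)] rot by simp
      fix n :: nat and j assume n: "1 \<le> n"
      show "entry k x n j = entry k y n j"
        using sign[OF n, of j] disp[OF n, of j] n entry_in_D_inf H(1) xy
        by (intro D_inf_eqI) (auto simp: entry_sign_def entry_disp_def)
    qed
  qed
qed

end

text \<open>A generator of the integers is odd, which is what makes the parity of the height equal to that of the
  number of factors \<open>s\<^sub>i\<close>.\<close>

locale dihedral_construction = long_cycle_lengths +
  fixes d :: "nat \<Rightarrow> nat" and \<sigma>\<^sub>0 :: int
  assumes d_eq: "1 \<le> n \<Longrightarrow> d n = n + 1"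
    and height_odd: "odd \<sigma>\<^sub>0"
begin

abbreviation "s \<equiv> elem_s \<sigma>\<^sub>0 d k"
abbreviation "t \<equiv> elem_t k"

lemma s_in_Delta: "s \<in> carrier (Delta k)"
  using k_pos
  by (auto simp: elem_s_def Delta_def DirProd_def H_group_def semidirect_def dih_power_def sigma_def
      carrier_integer_mod_group group.is_monoid monoid.one_closed)

lemma t_in_Delta: "t \<in> carrier (Delta k)"
  using long k_pos
  by (force simp: elem_t_def Delta_def DirProd_def H_group_def semidirect_def
      carrier_integer_mod_group monoid.one_closed[OF group.is_monoid[OF group_dih_power]])

lemma has_rotation_generators: "has_rotation k s 0" "has_rotation k t 1"
  using long by (force simp: has_rotation_def elem_s_def elem_t_def)+

lemma generators_rotated: "{s, t} \<subseteq> rotated_subgroup"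
  using s_in_Delta t_in_Delta has_rotation_generators by (auto simp: rotated_subgroup_def)

lemma subgroup_G: "subgroup (generate (Delta k) {s, t}) (Delta k)"
  using s_in_Delta t_in_Delta
  by (intro group.generate_is_subgroup[OF group_Delta_k]) simp

sublocale G: dihedral_coordinates "G_group \<sigma>\<^sub>0 d k" k "rotation k" fst "entry_sign k" "entry_disp k"
  unfolding G_group_def
  by (rule dihedral_coordinates_rotated[OF subgroup_G])
    (rule group.generate_subgroup_incl[OF group_Delta_k generators_rotated subgroup_rotated])

lemma generate_G: "generate (G_group \<sigma>\<^sub>0 d k) {s, t} = carrier (G_group \<sigma>\<^sub>0 d k)"
  using group.generate_consistent[OF group_Delta_k _ subgroup_G, of "{s, t}"]
  by (simp add: G_group_def generate.incl)

lemma generators_in_G: "s \<in> carrier (G_group \<sigma>\<^sub>0 d k)" "t \<in> carrier (G_group \<sigma>\<^sub>0 d k)"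
  by (simp_all add: G_group_def generate.incl)

lemma entry_s:
  assumes "1 \<le> n"
  shows "entry k s n j = (if (j - 1) mod int (k n) = 0 then dih_a
      else if (j - int n - 1) mod int (k n) = 0 then dih_b else \<one>\<^bsub>D_inf\<^esub>)"
proof -
  have "(j - int n - 1) mod int (k n) = 0 \<longleftrightarrow> (j - 1) mod int (k n) = int n mod int (k n)"
    by (simp add: mod_eq_dvd_iff mod_eq_0_iff_dvd algebra_simps)
  moreover have "int n mod int (k n) = int n" using long[OF assms] by simp
  ultimately show ?thesis
    using index_mod_range[OF assms, of j] assms
    by (auto simp: entry_def elem_s_def sigma_def index_mod_def d_eq)
qed

lemma entry_t: "1 \<le> n \<Longrightarrow> entry k t n j = \<one>\<^bsub>D_inf\<^esub>"
  using index_mod_range[of n j] by (simp add: entry_def elem_t_def dih_power_def)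

lemma hits_zero:
  "G.hits {0} n j = (if (j - 1) mod int (k n) = 0 then {0} else {})"
  by (auto simp: G.hits_def)

text \<open>Here \<open>k n > n\<close> ensures that the two nontrivial positions of \<open>s\<close> in level \<open>n\<close> are different.\<close>

lemma not_both_hit:
  assumes "1 \<le> n" "(j - 1) mod int (k n) = 0"
  shows "(j - int n - 1) mod int (k n) \<noteq> 0"
proof
  assume "(j - int n - 1) mod int (k n) = 0"
  then have "int (k n) dvd (j - 1) - (j - int n - 1)"
    using assms(2) by (simp only: mod_eq_0_iff_dvd) (rule dvd_diff)
  then have "k n dvd n" by simp
  then show False using dvd_imp_le[of "k n" n] long[OF assms(1)] assms(1) by simp
qed

lemma traces_generators: "G.parity_trace s {0}" "G.parity_trace t {}"
proof -
  show "G.parity_trace s {0}"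
    using height_odd not_both_hit
    by (auto simp: G.parity_trace_def hits_zero entry_sign_def entry_disp_def entry_s
        simp del: One_nat_def) (simp add: elem_s_def)
  show "G.parity_trace t {}"
    by (auto simp: G.parity_trace_def G.hits_def entry_sign_def entry_disp_def entry_t
        simp del: One_nat_def) (simp add: elem_t_def)
qed

lemma supports_generators: "G.supported s {0}" "G.supported t {}"
  by (auto simp: G.supported_def hits_zero entry_sign_def entry_disp_def entry_s entry_t
      split: if_splits simp del: One_nat_def)

sublocale G: traced_dihedral_coordinates "G_group \<sigma>\<^sub>0 d k" k "rotation k" fst "entry_sign k" "entry_disp k"
proof unfold_locales
  fix x assume "x \<in> carrier (G_group \<sigma>\<^sub>0 d k)"
  then have "x \<in> generate (G_group \<sigma>\<^sub>0 d k) {s, t}" by (simp add: generate_G)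
  then have "x \<in> carrier (G_group \<sigma>\<^sub>0 d k) \<and> (\<exists>E. G.parity_trace x E) \<and> (\<exists>F. G.supported x F)"
  proof (induction x rule: generate.induct)
    case one
    show ?case using G.parity_trace_one G.supported_one by blast
  next
    case (incl x)
    then show ?case using generators_in_G traces_generators supports_generators by blast
  next
    case (inv x)
    then show ?case
      using generators_in_G traces_generators supports_generators
        G.parity_trace_inv G.supported_inv G.inv_closed by blast
  next
    case (eng x y)
    then show ?case using G.parity_trace_mult G.supported_mult G.m_closed by blast
  qed
  then show "\<exists>E. G.parity_trace x E" "\<exists>F. G.supported x F" by blast+
qed

lemma finitely_generated_G: "finitely_generated (G_group \<sigma>\<^sub>0 d k)"
  unfolding finitely_generated_def
  using generators_in_G generate_G by (intro exI[of _ "{s, t}"]) simp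

lemma infinite_rank_G: "\<not> finite_rank (G_group \<sigma>\<^sub>0 d k)"
  using G.infinite_rank[OF generators_in_G(2) _ generators_in_G(1)] traces_generators(1)
    has_rotation_generators rotation_eq by blast

end

lemma generator_of_integers_odd:
  assumes "generate integer_group {\<sigma>\<^sub>0} = carrier integer_group"
  shows "odd \<sigma>\<^sub>0"
proof
  assume even: "even \<sigma>\<^sub>0"
  have "even x" if "x \<in> generate integer_group {\<sigma>\<^sub>0}" for x
    using that by (induction x rule: generate.induct) (use even in auto)
  from this[of 1] show False using assms by simp
qed

theorem corollary1p2:
  fixes d k :: "nat \<Rightarrow> nat" and \<sigma>\<^sub>0 :: int
  assumes "\<And>n. n \<ge> 1 \<Longrightarrow> d n = n + 1"
    and "\<And>n. n \<ge> 1 \<Longrightarrow> 0 < k n"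
    and "strict_mono_on {1..} k"
    and "\<And>n. n \<ge> 1 \<Longrightarrow> k n \<ge> 2 * d n"
    and "generate integer_group {\<sigma>\<^sub>0} = carrier integer_group"
  shows "group (G_group \<sigma>\<^sub>0 d k)
    \<and> finitely_generated (G_group \<sigma>\<^sub>0 d k)
    \<and> torsion_free (G_group \<sigma>\<^sub>0 d k)
    \<and> solvable (G_group \<sigma>\<^sub>0 d k)
    \<and> \<not> finite_rank (G_group \<sigma>\<^sub>0 d k)
    \<and> (\<forall>K. subgroup K (G_group \<sigma>\<^sub>0 d k)
          \<longrightarrow> finitely_generated ((G_group \<sigma>\<^sub>0 d k)\<lparr>carrier := K\<rparr>)
          \<longrightarrow> metabelian ((G_group \<sigma>\<^sub>0 d k)\<lparr>carrier := K\<rparr>)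
          \<longrightarrow> virtually_abelian ((G_group \<sigma>\<^sub>0 d k)\<lparr>carrier := K\<rparr>))"
proof -
  interpret dihedral_construction k d \<sigma>\<^sub>0
  proof
    fix n :: nat assume n: "1 \<le> n"
    show "2 * n + 2 \<le> k n" using assms(1,4)[OF n] by simp
    show "d n = n + 1" using assms(1)[OF n] .
  next
    show "odd \<sigma>\<^sub>0" using assms(5) by (rule generator_of_integers_odd)
  qed
  have "virtually_abelian ((G_group \<sigma>\<^sub>0 d k)\<lparr>carrier := K\<rparr>)"
    if "subgroup K (G_group \<sigma>\<^sub>0 d k)" "finitely_generated ((G_group \<sigma>\<^sub>0 d k)\<lparr>carrier := K\<rparr>)"
      "metabelian ((G_group \<sigma>\<^sub>0 d k)\<lparr>carrier := K\<rparr>)" for K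
    using traced_dihedral_coordinates.virtually_abelian_if_metabelian[OF G.traced_subgroup] that
    by blast
  then show ?thesis
    using G.is_group finitely_generated_G G.torsion_free_coordinates G.solvable_coordinates
      infinite_rank_G by blast
qed

end
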